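(* Let $A\in\mathbb S_d^g$ be a $g$-tuple such that $\mathcal D_{L_A}$ is bounded. Suppose $\mathcal D_{L_A}$ has the property that $$\text{if }C\in\mathcal D_{L_A}\text{ and }1\le j\le g,\text{ then }\hat C_j=(0,\dots,0,C_j,0,\dots,0)\in\mathcal D_{L_A}\tag{$*$}$$ (with $C_j$ in the $j$-th position). If $C\in\mathcal D_{L_A}(n)$, then there exists a commuting tuple $T\in\mathcal D_{L_A}(gn)$ such that $C$ dilates to $gT$. The estimate is sharp in that $\rho=g$ is the smallest number $\rho$ such that for every $g$-tuple $A$ (of symmetric matrices of some common size, with $\mathcal D_{L_A}$ bounded and satisfying $( * )$), every $n$, and every $g$-tuple $X\in\mathcal D_{L_A}(n)$ there exists a commuting $g$-tuple $T$ of symmetric matrices of size $gn$ such that $X$ dilates to $\rho T$ and the joint spectrum of $T$ lies in $\mathcal D_{L_A}(1)$.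
   Context: $\mathbb S_n$ is the set of real symmetric $n\times n$ matrices. For $A=(A_1,\dots,A_g)\in\mathbb S_d^g$: $\mathcal D_{L_A}(n)=\{X\in\mathbb S_n^g:L_A(X)=I_{dn}-\sum_jA_j\otimes X_j\succeq0\}$ and $\mathcal D_{L_A}=(\mathcal D_{L_A}(n))_n$; $X\in\mathcal D_{L_A}$ means $X\in\mathcal D_{L_A}(n)$ for some $n$. A tuple $X\in\mathbb S_n^g$ dilates to a tuple $T$ of operators on a Hilbert space $\mathcal H$ if there is an isometry $V:\mathbb R^n\to\mathcal H$ with $X_j=V^*T_jV$ for all $j$. *)

theory Defs
  imports Complex_Main "Jordan_Normal_Form.Matrix"
begin

text \<open>
  Matrix sizes vary inside the statement, so matrices are those with explicit carriers.
  A \<open>g\<close>-tuple is a function on \<open>nat\<close> of which only the entries at \<open>0, \<dots>, g - 1\<close>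
  are ever inspected; the values at other indices are arbitrary.
\<close>

type_synonym mat_tuple = "nat \<Rightarrow> real mat"

definition sym_mats :: "nat \<Rightarrow> real mat set" where
  "sym_mats n = {M \<in> carrier_mat n n. transpose_mat M = M}"

definition sym_tuples :: "nat \<Rightarrow> nat \<Rightarrow> mat_tuple set" where
  "sym_tuples g n = {X. \<forall>j<g. X j \<in> sym_mats n}"

definition psd :: "nat \<Rightarrow> real mat \<Rightarrow> bool" where
  "psd n M \<longleftrightarrow> M \<in> sym_mats n \<and> (\<forall>v \<in> carrier_vec n. v \<bullet> (M *\<^sub>v v) \<ge> 0)"

definition kronecker :: "real mat \<Rightarrow> real mat \<Rightarrow> real mat" where
  "kronecker A B = mat (dim_row A * dim_row B) (dim_col A * dim_col B)
     (\<lambda>(r, c). A $$ (r div dim_row B, c div dim_col B) * B $$ (r mod dim_row B, c mod dim_col B))"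

definition tuple_sum :: "nat \<Rightarrow> nat \<Rightarrow> mat_tuple \<Rightarrow> real mat" where
  "tuple_sum m g M = mat m m (\<lambda>rc. \<Sum>j<g. M j $$ rc)"

definition lin_pencil :: "nat \<Rightarrow> nat \<Rightarrow> mat_tuple \<Rightarrow> nat \<Rightarrow> mat_tuple \<Rightarrow> real mat" where
  "lin_pencil g d A n X = 1\<^sub>m (d * n) - tuple_sum (d * n) g (\<lambda>j. kronecker (A j) (X j))"

definition free_spectrahedron :: "nat \<Rightarrow> nat \<Rightarrow> mat_tuple \<Rightarrow> nat \<Rightarrow> mat_tuple set" where
  "free_spectrahedron g d A n = {X \<in> sym_tuples g n. psd (d * n) (lin_pencil g d A n X)}"

definition eucl_norm :: "real vec \<Rightarrow> real" where
  "eucl_norm v = sqrt (v \<bullet> v)"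

text \<open>Boundedness is in operator norm, with one bound for all levels \<open>n\<close>.\<close>

definition free_bounded :: "nat \<Rightarrow> (nat \<Rightarrow> mat_tuple set) \<Rightarrow> bool" where
  "free_bounded g D \<longleftrightarrow>
     (\<exists>N. \<forall>n. \<forall>X \<in> D n. \<forall>j<g. \<forall>v \<in> carrier_vec n. eucl_norm (X j *\<^sub>v v) \<le> N * eucl_norm v)"

definition coord_tuple :: "nat \<Rightarrow> nat \<Rightarrow> mat_tuple \<Rightarrow> mat_tuple" where
  "coord_tuple n j C = (\<lambda>i. if i = j then C j else 0\<^sub>m n n)"

definition coord_closed :: "nat \<Rightarrow> (nat \<Rightarrow> mat_tuple set) \<Rightarrow> bool" where
  "coord_closed g D \<longleftrightarrow> (\<forall>n. \<forall>C \<in> D n. \<forall>j<g. coord_tuple n j C \<in> D n)"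

definition commuting_tuple :: "nat \<Rightarrow> mat_tuple \<Rightarrow> bool" where
  "commuting_tuple g T \<longleftrightarrow> (\<forall>i<g. \<forall>j<g. T i * T j = T j * T i)"

definition scale_tuple :: "real \<Rightarrow> mat_tuple \<Rightarrow> mat_tuple" where
  "scale_tuple r T = (\<lambda>j. r \<cdot>\<^sub>m T j)"

text \<open>Dilation to a tuple of operators on \<open>\<real>\<^sup>m\<close>, the only Hilbert spaces needed here.\<close>

definition dilates_to :: "nat \<Rightarrow> nat \<Rightarrow> nat \<Rightarrow> mat_tuple \<Rightarrow> mat_tuple \<Rightarrow> bool" where
  "dilates_to g n m X T \<longleftrightarrow>
     (\<exists>V \<in> carrier_mat m n. transpose_mat V * V = 1\<^sub>m n \<and>
        (\<forall>j<g. X j = transpose_mat V * T j * V))"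

text \<open>
  For commuting symmetric matrices of size \<open>m\<close> the joint spectrum is the set of
  tuples of joint eigenvalues.
\<close>

definition joint_spectrum :: "nat \<Rightarrow> nat \<Rightarrow> mat_tuple \<Rightarrow> (nat \<Rightarrow> real) set" where
  "joint_spectrum g m T =
     {l. \<exists>v \<in> carrier_vec m. v \<noteq> 0\<^sub>v m \<and> (\<forall>j<g. T j *\<^sub>v v = l j \<cdot>\<^sub>v v)}"

definition scalar_tuple :: "(nat \<Rightarrow> real) \<Rightarrow> mat_tuple" where
  "scalar_tuple l = (\<lambda>j. mat 1 1 (\<lambda>_. l j))"

end

theory Submission
  imports Defs "HOL-Analysis.Function_Topology"
begin

text \<open>
  The dilation is elementary. Spread \<open>C\<close> over \<open>g\<close> orthogonal copies of \<open>\<real>\<^sup>n\<close>, letting \<open>T\<^sub>j\<close> act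
  as \<open>C\<^sub>j\<close> on the \<open>j\<close>-th copy and as \<open>0\<close> on the others. Products of different \<open>T\<^sub>j\<close> vanish, so they
  commute; \<open>T\<close> is the direct sum of the coordinate tuples of \<open>C\<close>, each of which lies in the free
  spectrahedron by coordinate closedness, and positivity of the pencil passes to direct sums.
  The normalised diagonal embedding \<open>\<real>\<^sup>n \<rightarrow> \<real>\<^sup>g\<^sup>n\<close> compresses \<open>g T\<^sub>j\<close> to \<open>C\<^sub>j\<close>. Testing the pencil of
  \<open>T\<close> on \<open>y \<otimes> v\<close> for a joint eigenvector \<open>v\<close> puts the joint spectrum of \<open>T\<close> into level \<open>1\<close>.

  Sharpness rests on a bound for compressions of commuting tuples
  (\<open>commuting_compression_bound\<close>). Let \<open>B\<^sub>j\<close> be symmetric with \<open>\<Sum>\<^sub>j t\<^sub>j B\<^sub>j \<le> R I\<close> for every \<open>t\<close> in the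
  joint spectrum of \<open>T\<close>. Then \<open>Z \<mapsto> \<Sum>\<^sub>j T\<^sub>j Z B\<^sub>j\<close> on matrices \<open>Z\<close>, with the Frobenius inner product, is
  at most \<open>R\<close>: it commutes with all \<open>Z \<mapsto> T\<^sub>j Z\<close>, so its largest eigenvalue is attained at a joint
  eigenvector of these operators, where it becomes \<open>Z \<mapsto> Z (\<Sum>\<^sub>j t\<^sub>j B\<^sub>j)\<close>. Evaluated at an isometry
  \<open>V\<close> from \<open>\<real>\<^sup>n\<close> this reads \<open>\<Sum>\<^sub>j tr (B\<^sub>j V\<^sup>* T\<^sub>j V) \<le> R n\<close>. The joint eigenvector comes from maximising
  Rayleigh quotients one operator after the other (\<open>joint_eigenvector\<close>).

  Take for \<open>X\<close> a tuple \<open>F\<close> of anticommuting symmetric involutions. As \<open>(\<Sum>\<^sub>j t\<^sub>j F\<^sub>j)\<^sup>2 = |t|\<^sup>2 I\<close>, it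
  satisfies every linear inequality \<open>\<Sum>\<^sub>j a\<^sub>j X\<^sub>j \<le> I\<close> with \<open>|a| \<le> 1\<close>. Finitely many of these
  inequalities, with \<open>a\<close> on a grid, define a bounded coordinate-closed free spectrahedron whose first level lies
  in a ball of radius \<open>R\<close> close to \<open>1\<close> (\<open>ball_grid_spectrahedron\<close>). If \<open>F\<^sub>j = \<rho> V\<^sup>* T\<^sub>j V\<close> with \<open>\<rho> > 0\<close>, the
  bound with \<open>B = F\<close> gives \<open>g n / \<rho> = \<Sum>\<^sub>j tr (F\<^sub>j\<^sup>2) / \<rho> \<le> R n\<close>, and \<open>R \<rightarrow> 1\<close> yields \<open>g \<le> \<rho>\<close>. This family
  is symmetric under \<open>X \<mapsto> - X\<close> and cannot see the sign of \<open>\<rho>\<close>; nonpositive \<open>\<rho>\<close> are excluded by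
  a spectrahedron that reaches far in the positive but only to \<open>- 1\<close> in the negative coordinate
  directions (\<open>admissible_scale_pos\<close>).
\<close>

section \<open>Joint eigenvectors of commuting symmetric kernels\<close>

lemma linear_term_zero_if_quadratic_nonneg:
  fixes q c :: real
  assumes "\<And>t. t * (2 * q) + t\<^sup>2 * c \<ge> 0"
  shows "q = 0"
proof (rule ccontr)
  assume q: "q \<noteq> 0"
  \<comment> \<open>A step \<open>t = - s q\<close> this short makes the linear term dominate the quadratic one.\<close>
  define s where "s = 1 / (\<bar>c\<bar> + 1)"
  have s: "s > 0" "s * \<bar>c\<bar> < 1" by (auto simp: s_def field_simps)
  have "0 \<le> (- s * q) * (2 * q) + (- s * q)\<^sup>2 * c" by (rule assms)
  also have "\<dots> = s * q\<^sup>2 * (s * c - 2)" by (simp add: power2_eq_square algebra_simps)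
  also have "\<dots> < 0"
  proof -
    have "s * c \<le> s * \<bar>c\<bar>" using s(1) by (intro mult_left_mono) auto
    then have "s * c - 2 < 0" using s(2) by linarith
    moreover have "s * q\<^sup>2 > 0" using s(1) q by simp
    ultimately show ?thesis by (rule mult_pos_neg[rotated])
  qed
  finally show False by simp
qed

lemma compact_box_functions:
  fixes I :: "'i set"
  shows "compact {f :: 'i \<Rightarrow> real. (\<forall>i\<in>I. \<bar>f i\<bar> \<le> 1) \<and> (\<forall>i. i \<notin> I \<longrightarrow> f i = 0)}"
proof -
  let ?B = "\<lambda>i. if i \<in> I then {-1..1::real} else {0}"
  have "compactin (product_topology (\<lambda>i::'i. euclidean :: real topology) UNIV) (PiE UNIV ?B)"
    unfolding compactin_PiE by auto
  then have "compact (PiE UNIV ?B)"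
    by (simp add: euclidean_product_topology)
  also have "PiE UNIV ?B = {f. (\<forall>i\<in>I. \<bar>f i\<bar> \<le> 1) \<and> (\<forall>i. i \<notin> I \<longrightarrow> f i = 0)}"
    by (auto simp: PiE_def Pi_def abs_le_iff split: if_splits; metis atLeastAtMost_iff singletonD minus_le_iff)
  finally show ?thesis .
qed

definition kernel_form :: "'i set \<Rightarrow> ('i \<Rightarrow> 'i \<Rightarrow> real) \<Rightarrow> ('i \<Rightarrow> real) \<Rightarrow> ('i \<Rightarrow> real) \<Rightarrow> real"
  where "kernel_form I a f h = (\<Sum>i\<in>I. f i * (\<Sum>k\<in>I. a i k * h k))"

lemma kernel_form_add_scale:
  assumes sym: "\<And>i k. i \<in> I \<Longrightarrow> k \<in> I \<Longrightarrow> a i k = a k i"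
  shows "kernel_form I a (\<lambda>i. f i + t * h i) (\<lambda>i. f i + t * h i)
       = kernel_form I a f f + t * (2 * kernel_form I a h f) + t\<^sup>2 * kernel_form I a h h"
proof -
  have s: "kernel_form I a f h = kernel_form I a h f"
  proof -
    have "kernel_form I a f h = (\<Sum>i\<in>I. \<Sum>k\<in>I. f i * a i k * h k)"
      by (simp add: kernel_form_def sum_distrib_left mult.assoc)
    also have "\<dots> = (\<Sum>k\<in>I. \<Sum>i\<in>I. f i * a i k * h k)" by (rule sum.swap)
    also have "\<dots> = (\<Sum>k\<in>I. \<Sum>i\<in>I. h k * (a k i * f i))"
      by (intro sum.cong refl) (simp add: sym mult.commute mult.left_commute)
    finally show ?thesis by (simp add: kernel_form_def sum_distrib_left)
  qed
  have "kernel_form I a (\<lambda>i. f i + t * h i) (\<lambda>i. f i + t * h i)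
      = kernel_form I a f f + t * kernel_form I a h f + (t * kernel_form I a f h + t\<^sup>2 * kernel_form I a h h)"
    unfolding kernel_form_def by (simp add: algebra_simps sum.distrib sum_distrib_left power2_eq_square)
  then show ?thesis by (simp add: s)
qed

text \<open>
  The Rayleigh quotient attains its maximum on the unit sphere of \<open>W\<close>, which is compact because only the
  finitely many coordinates in \<open>I\<close> vary; a maximiser is an eigenvector because \<open>W\<close> is invariant.
  Operators are given by kernels on a finite index set of arbitrary type, so that pairs of indices can
  serve as well as numbers.
\<close>

lemma maximal_eigenvector_in_subspace:
  fixes I :: "'i set" and W :: "('i \<Rightarrow> real) set"
  assumes fin: "finite I"
    and sym: "\<And>i k. i \<in> I \<Longrightarrow> k \<in> I \<Longrightarrow> a i k = a k i"
    and W0: "\<And>f i. f \<in> W \<Longrightarrow> i \<notin> I \<Longrightarrow> f i = 0"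
    and Wcl: "closed W"
    and Wlin: "\<And>f h t. f \<in> W \<Longrightarrow> h \<in> W \<Longrightarrow> (\<lambda>i. f i + t * h i) \<in> W"
    and Winv: "\<And>f. f \<in> W \<Longrightarrow> (\<lambda>i. if i \<in> I then \<Sum>k\<in>I. a i k * f k else 0) \<in> W"
    and ne: "f0 \<in> W" "\<exists>i\<in>I. f0 i \<noteq> 0"
  obtains v \<mu> where "v \<in> W" "\<exists>i\<in>I. v i \<noteq> 0" "\<And>i. i \<in> I \<Longrightarrow> (\<Sum>k\<in>I. a i k * v k) = \<mu> * v i"
    "\<And>f. f \<in> W \<Longrightarrow> kernel_form I a f f \<le> \<mu> * (\<Sum>i\<in>I. (f i)\<^sup>2)"
proof -
  define nsq where "nsq f = (\<Sum>i\<in>I. (f i)\<^sup>2)" for f :: "'i \<Rightarrow> real"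
  define K where "K = {f \<in> W. nsq f = 1}"
  have c: "continuous_on UNIV (\<lambda>f::'i \<Rightarrow> real. f i)" for i by simp
  have K_alt: "K = {f. (\<forall>i\<in>I. \<bar>f i\<bar> \<le> 1) \<and> (\<forall>i. i \<notin> I \<longrightarrow> f i = 0)} \<inter> (W \<inter> {f. nsq f = 1})"
  proof -
    have "\<bar>f i\<bar> \<le> 1" if "i \<in> I" "nsq f = 1" for f :: "'i \<Rightarrow> real" and i
    proof -
      have "(f i)\<^sup>2 \<le> nsq f" unfolding nsq_def using fin that(1) by (intro member_le_sum) auto
      then show ?thesis using that(2) by (simp add: abs_square_le_1)
    qed
    then show ?thesis using W0 by (auto simp: K_def)
  qed
  have "closed {f. nsq f = 1}"
    unfolding nsq_def by (intro closed_Collect_eq continuous_intros c)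
  then have "compact K"
    unfolding K_alt using Wcl by (intro compact_Int_closed compact_box_functions closed_Int)
  have scale: "(\<lambda>i. s * f i) \<in> W" if "f \<in> W" for f s
    using Wlin[OF that that, of "s - 1"] by (simp add: algebra_simps)
  have kernel_form_scale: "kernel_form I a (\<lambda>i. s * f i) (\<lambda>i. s * f i) = s\<^sup>2 * kernel_form I a f f" for s f
    by (simp add: kernel_form_def sum_distrib_left power2_eq_square algebra_simps)
  have nsq_scale: "nsq (\<lambda>i. s * f i) = s\<^sup>2 * nsq f" for s f
    by (simp add: nsq_def sum_distrib_left power_mult_distrib)
  have nsq_nonneg: "nsq f \<ge> 0" for f by (simp add: nsq_def sum_nonneg)
  have nsq_0: "nsq f = 0 \<longleftrightarrow> (\<forall>i\<in>I. f i = 0)" for f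
    by (simp add: nsq_def sum_nonneg_eq_0_iff fin)
  have normalise: "(\<lambda>i. (1 / sqrt (nsq f)) * f i) \<in> K" if "f \<in> W" "nsq f \<noteq> 0" for f
    using that nsq_nonneg[of f] scale[OF that(1), of "1 / sqrt (nsq f)"]
    unfolding K_def mem_Collect_eq nsq_scale by (simp add: power_divide)
  have "nsq f0 \<noteq> 0" using ne(2) nsq_0 by auto
  then have "K \<noteq> {}" using normalise[OF ne(1)] by auto
  have "continuous_on K (\<lambda>f. kernel_form I a f f)"
    unfolding kernel_form_def by (rule continuous_on_subset[of UNIV]) (intro continuous_intros c, simp)
  from continuous_attains_sup[OF \<open>compact K\<close> \<open>K \<noteq> {}\<close> this]
  obtain v where v: "v \<in> K" and vmax: "\<And>f. f \<in> K \<Longrightarrow> kernel_form I a f f \<le> kernel_form I a v v" by auto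
  define \<mu> where "\<mu> = kernel_form I a v v"
  have vW: "v \<in> W" and v1: "nsq v = 1" using v by (auto simp: K_def)
  have max: "kernel_form I a f f \<le> \<mu> * nsq f" if "f \<in> W" for f
  proof (cases "nsq f = 0")
    case True
    then have "kernel_form I a f f = 0" using nsq_0 by (auto simp: kernel_form_def)
    then show ?thesis using True by simp
  next
    case False
    then have p: "nsq f > 0" using nsq_nonneg[of f] by linarith
    from vmax[OF normalise[OF that False]]
    have "kernel_form I a f f / nsq f \<le> \<mu>" using p unfolding kernel_form_scale \<mu>_def by (simp add: power_divide)
    then show ?thesis using p by (simp add: field_simps)
  qed
  \<comment> \<open>The deviation of \<open>v\<close> from being an eigenvector lies in \<open>W\<close>, and the first variation of
     \<open>\<mu> |f|\<^sup>2 - kernel_form I a f f\<close> at its minimiser \<open>v\<close> in that direction must vanish.\<close>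
  define h where "h i = (if i \<in> I then \<Sum>k\<in>I. a i k * v k else 0) + (- \<mu>) * v i" for i
  have hW: "h \<in> W" unfolding h_def by (intro Wlin Winv vW)
  have hI: "h i = (\<Sum>k\<in>I. a i k * v k) - \<mu> * v i" if "i \<in> I" for i
    using that by (simp add: h_def)
  define q where "q = \<mu> * (\<Sum>i\<in>I. h i * v i) - kernel_form I a h v"
  have "t * (2 * q) + t\<^sup>2 * (\<mu> * nsq h - kernel_form I a h h) \<ge> 0" for t
  proof -
    have "nsq (\<lambda>i. v i + t * h i) = nsq v + t * (2 * (\<Sum>i\<in>I. h i * v i)) + t\<^sup>2 * nsq h"
      unfolding nsq_def by (simp add: power2_eq_square algebra_simps sum.distrib sum_distrib_left)
    moreover have "kernel_form I a (\<lambda>i. v i + t * h i) (\<lambda>i. v i + t * h i) \<le> \<mu> * nsq (\<lambda>i. v i + t * h i)"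
      by (intro max Wlin vW hW)
    moreover have "kernel_form I a (\<lambda>i. v i + t * h i) (\<lambda>i. v i + t * h i)
        = kernel_form I a v v + t * (2 * kernel_form I a h v) + t\<^sup>2 * kernel_form I a h h"
      by (rule kernel_form_add_scale) (rule sym)
    ultimately show ?thesis using v1
      by (simp add: q_def \<mu>_def[symmetric] algebra_simps)
  qed
  then have "q = 0" by (rule linear_term_zero_if_quadratic_nonneg)
  moreover have "q = - nsq h"
  proof -
    have "kernel_form I a h v = (\<Sum>i\<in>I. h i * (h i + \<mu> * v i))"
      unfolding kernel_form_def by (intro sum.cong refl) (simp add: hI)
    then show ?thesis
      by (simp add: q_def nsq_def power2_eq_square algebra_simps sum.distrib sum_distrib_left)
  qed
  ultimately have "\<forall>i\<in>I. h i = 0" using nsq_0 by simp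
  then have eig: "(\<Sum>k\<in>I. a i k * v k) = \<mu> * v i" if "i \<in> I" for i using that hI by simp
  have "nsq v \<noteq> 0" using v1 by simp
  then have "\<exists>i\<in>I. v i \<noteq> 0" using nsq_0 by blast
  then show ?thesis by (rule that[OF vW _ eig max[unfolded nsq_def]])
qed

text \<open>
  Only the first operator has to be maximised over the whole space: its top eigenspace is invariant under
  the others, and each further operator has an eigenvector in the joint eigenspace found so far.
\<close>

lemma joint_eigenvector:
  fixes I :: "'i set" and a :: "nat \<Rightarrow> 'i \<Rightarrow> 'i \<Rightarrow> real"
  assumes fin: "finite I" and "I \<noteq> {}"
    and sym: "\<And>j i k. j \<le> g \<Longrightarrow> i \<in> I \<Longrightarrow> k \<in> I \<Longrightarrow> a j i k = a j k i"
    and comm: "\<And>j l i k. j \<le> g \<Longrightarrow> l \<le> g \<Longrightarrow> i \<in> I \<Longrightarrow> k \<in> I \<Longrightarrow>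
                 (\<Sum>p\<in>I. a j i p * a l p k) = (\<Sum>p\<in>I. a l i p * a j p k)"
  obtains v \<mu> where "\<exists>i\<in>I. v i \<noteq> 0"
    "\<And>j i. j \<le> g \<Longrightarrow> i \<in> I \<Longrightarrow> (\<Sum>k\<in>I. a j i k * v k) = \<mu> j * v i"
    "\<And>f. kernel_form I (a 0) f f \<le> \<mu> 0 * (\<Sum>i\<in>I. (f i)\<^sup>2)"
proof -
  have "\<exists>v \<mu>. (\<exists>i\<in>I. v i \<noteq> 0) \<and> (\<forall>i. i \<notin> I \<longrightarrow> v i = 0)
      \<and> (\<forall>j\<le>l. \<forall>i\<in>I. (\<Sum>k\<in>I. a j i k * v k) = \<mu> j * v i)
      \<and> (\<forall>f. kernel_form I (a 0) f f \<le> \<mu> 0 * (\<Sum>i\<in>I. (f i)\<^sup>2))" if "l \<le> g" for l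
    using that
  proof (induction l)
    case 0
    let ?W = "{f :: 'i \<Rightarrow> real. \<forall>i. i \<notin> I \<longrightarrow> f i = 0}"
    have "closed ?W"
      by (intro closed_Collect_all closed_Collect_imp closed_Collect_eq continuous_intros) auto
    moreover obtain i0 where "i0 \<in> I" using \<open>I \<noteq> {}\<close> by auto
    ultimately obtain v \<mu> where v: "v \<in> ?W" "\<exists>i\<in>I. v i \<noteq> 0" 
      "\<And>i. i \<in> I \<Longrightarrow> (\<Sum>k\<in>I. a 0 i k * v k) = \<mu> * v i"
      "\<And>f. f \<in> ?W \<Longrightarrow> kernel_form I (a 0) f f \<le> \<mu> * (\<Sum>i\<in>I. (f i)\<^sup>2)"
      by (rule_tac maximal_eigenvector_in_subspace[of I "a 0" ?W "\<lambda>i. if i = i0 then 1 else 0"])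
         (auto simp: fin sym)
    \<comment> \<open>The form ignores coordinates outside \<open>I\<close>, so the support condition of \<open>?W\<close> can be dropped.\<close>
    have "kernel_form I (a 0) f f \<le> \<mu> * (\<Sum>i\<in>I. (f i)\<^sup>2)" for f
      using v(4)[of "\<lambda>i. if i \<in> I then f i else 0"] by (simp add: kernel_form_def)
    then show ?case using v by (intro exI[of _ v] exI[of _ "\<lambda>_. \<mu>"]) auto
  next
    case (Suc l)
    then obtain v0 \<mu> where v0: "\<exists>i\<in>I. v0 i \<noteq> 0" "\<forall>i. i \<notin> I \<longrightarrow> v0 i = 0"
      "\<forall>j\<le>l. \<forall>i\<in>I. (\<Sum>k\<in>I. a j i k * v0 k) = \<mu> j * v0 i"
      "\<forall>f. kernel_form I (a 0) f f \<le> \<mu> 0 * (\<Sum>i\<in>I. (f i)\<^sup>2)" by fastforce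
    let ?W = "{f :: 'i \<Rightarrow> real. (\<forall>i. i \<notin> I \<longrightarrow> f i = 0)
                 \<and> (\<forall>j\<le>l. \<forall>i\<in>I. (\<Sum>k\<in>I. a j i k * f k) = \<mu> j * f i)}"
    have cl: "closed ?W"
      unfolding Ball_def
      by (intro closed_Collect_conj closed_Collect_all closed_Collect_imp closed_Collect_eq
            continuous_intros continuous_on_product_coordinates) auto
    have inv: "(\<lambda>i. if i \<in> I then \<Sum>k\<in>I. a (Suc l) i k * f k else 0) \<in> ?W" if f: "f \<in> ?W" for f
    proof -
      have "(\<Sum>k\<in>I. a j i k * (\<Sum>p\<in>I. a (Suc l) k p * f p)) = \<mu> j * (\<Sum>k\<in>I. a (Suc l) i k * f k)"
        if j: "j \<le> l" and i: "i \<in> I" for j i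
      proof -
        have "(\<Sum>k\<in>I. a j i k * (\<Sum>p\<in>I. a (Suc l) k p * f p))
            = (\<Sum>p\<in>I. (\<Sum>k\<in>I. a j i k * a (Suc l) k p) * f p)"
          unfolding sum_distrib_left sum_distrib_right
          by (subst sum.swap) (simp add: mult.assoc)
        also have "\<dots> = (\<Sum>p\<in>I. (\<Sum>k\<in>I. a (Suc l) i k * a j k p) * f p)"
          by (intro sum.cong refl) (use comm[of j "Suc l" i] j i Suc.prems in auto)
        also have "\<dots> = (\<Sum>k\<in>I. a (Suc l) i k * (\<Sum>p\<in>I. a j k p * f p))"
          unfolding sum_distrib_left sum_distrib_right
          by (subst sum.swap) (simp add: mult.assoc)
        also have "\<dots> = (\<Sum>k\<in>I. a (Suc l) i k * (\<mu> j * f k))"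
          using f j by (intro sum.cong refl) auto
        finally show ?thesis by (simp add: sum_distrib_left algebra_simps)
      qed
      then show ?thesis by auto
    qed
    have lin: "(\<lambda>i. f i + t * h i) \<in> ?W" if "f \<in> ?W" "h \<in> ?W" for f h t
    proof -
      have "(\<Sum>k\<in>I. a j i k * (f k + t * h k)) = \<mu> j * (f i + t * h i)" if "j \<le> l" "i \<in> I" for j i
      proof -
        have "(\<Sum>k\<in>I. a j i k * (f k + t * h k)) = (\<Sum>k\<in>I. a j i k * f k) + t * (\<Sum>k\<in>I. a j i k * h k)"
          by (simp add: algebra_simps sum.distrib sum_distrib_left)
        then show ?thesis using that \<open>f \<in> ?W\<close> \<open>h \<in> ?W\<close> by (simp add: algebra_simps)
      qed
      then show ?thesis using that by auto
    qed
    obtain v \<nu> where v: "v \<in> ?W" "\<exists>i\<in>I. v i \<noteq> 0" 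
      "\<And>i. i \<in> I \<Longrightarrow> (\<Sum>k\<in>I. a (Suc l) i k * v k) = \<nu> * v i"
    proof (rule maximal_eigenvector_in_subspace[of I "a (Suc l)" ?W v0])
      show "v0 \<in> ?W" using v0 by auto
    qed (use fin sym Suc.prems cl lin inv v0(1) in auto)
    have "\<forall>j\<le>Suc l. \<forall>i\<in>I. (\<Sum>k\<in>I. a j i k * v k) = (\<mu>(Suc l := \<nu>)) j * v i"
      using v by (auto simp: le_Suc_eq)
    then show ?case using v v0(4) by (intro exI[of _ v] exI[of _ "\<mu>(Suc l := \<nu>)"]) auto
  qed
  from this[OF order_refl] show ?thesis
  proof (elim exE conjE)
    fix v \<mu> assume "\<exists>i\<in>I. v i \<noteq> 0" "\<forall>j\<le>g. \<forall>i\<in>I. (\<Sum>k\<in>I. a j i k * v k) = \<mu> j * v i"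
      "\<forall>f. kernel_form I (a 0) f f \<le> \<mu> 0 * (\<Sum>i\<in>I. (f i)\<^sup>2)"
    then show thesis by (intro that[of v \<mu>]) auto
  qed
qed

section \<open>Matrix entries and bilinear forms\<close>

definition bform :: "nat \<Rightarrow> real mat \<Rightarrow> (nat \<Rightarrow> real) \<Rightarrow> (nat \<Rightarrow> real) \<Rightarrow> real" where
  "bform n M x y = (\<Sum>k<n. \<Sum>l<n. x k * M $$ (k, l) * y l)"

abbreviation qform :: "nat \<Rightarrow> real mat \<Rightarrow> (nat \<Rightarrow> real) \<Rightarrow> real" where
  "qform n M y \<equiv> bform n M y y"

lemma sym_mats_entry: "M \<in> sym_mats n \<Longrightarrow> i < n \<Longrightarrow> k < n \<Longrightarrow> M $$ (i, k) = M $$ (k, i)"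
  unfolding sym_mats_def using index_transpose_mat(1)[of i M k] by auto

lemma sym_matsI:
  assumes "M \<in> carrier_mat n n" "\<And>i k. i < n \<Longrightarrow> k < n \<Longrightarrow> M $$ (i, k) = M $$ (k, i)"
  shows "M \<in> sym_mats n"
  using assms by (auto simp: sym_mats_def intro!: eq_matI)

lemma mult_entry:
  assumes "M \<in> carrier_mat m p" "N \<in> carrier_mat p n" "i < m" "k < n"
  shows "(M * N) $$ (i, k) = (\<Sum>q<p. M $$ (i, q) * N $$ (q, k))"
  using assms by (simp add: scalar_prod_def atLeast0LessThan)

lemma compression_entry:
  assumes T: "T \<in> carrier_mat m m" and V: "V \<in> carrier_mat m n" and "k < n" "l < n"
  shows "(transpose_mat V * T * V) $$ (k, l) = bform m T (\<lambda>i. V $$ (i, k)) (\<lambda>i. V $$ (i, l))"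
proof -
  have "(transpose_mat V * T * V) $$ (k, l) = (\<Sum>i'<m. (\<Sum>i<m. V $$ (i, k) * T $$ (i, i')) * V $$ (i', l))"
    using assms by (simp add: mult_entry[of _ n m] mult_entry[of _ n m _ m] del: index_mult_mat(1) assoc_mult_mat)
  then show ?thesis unfolding sum_distrib_right bform_def by (subst (asm) sum.swap)
qed

lemma mult_vec_entry:
  assumes "M \<in> carrier_mat m n" "i < m"
  shows "(M *\<^sub>v vec n x) $ i = (\<Sum>k<n. M $$ (i, k) * x k)"
  using assms by (simp add: scalar_prod_def atLeast0LessThan)

section \<open>A bound for compressions of commuting tuples\<close>

lemma joint_spectrumI:
  assumes T: "\<And>j. j < g \<Longrightarrow> T j \<in> carrier_mat m m"
    and eig: "\<And>j i. j < g \<Longrightarrow> i < m \<Longrightarrow> (\<Sum>k<m. T j $$ (i, k) * x k) = t j * x i"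
    and ne: "i < m" "x i \<noteq> 0"
  shows "t \<in> joint_spectrum g m T"
proof -
  have "vec m x \<noteq> 0\<^sub>v m" using ne by (metis index_vec index_zero_vec(1))
  moreover have "T j *\<^sub>v vec m x = t j \<cdot>\<^sub>v vec m x" if "j < g" for j
    using T[OF that] eig[OF that] by (intro eq_vecI) (simp_all add: mult_vec_entry[OF T[OF that]] del: index_mult_mat_vec)
  ultimately show ?thesis unfolding joint_spectrum_def by (intro CollectI bexI[of _ "vec m x"]) auto
qed

text \<open>
  The left-hand side is the value at \<open>V\<close> of the quadratic form of \<open>Z \<mapsto> \<Sum>\<^sub>j T\<^sub>j Z B\<^sub>j\<close> with respect to the Frobenius inner product.
  On a joint eigenvector \<open>Z\<close> of the commuting operators \<open>Z \<mapsto> T\<^sub>j Z\<close>, with eigenvalues \<open>t\<^sub>j\<close>, the nonzero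
  columns of \<open>Z\<close> are joint eigenvectors of \<open>T\<close> and the operator acts on the rows of \<open>Z\<close> as \<open>\<Sum>\<^sub>j t\<^sub>j B\<^sub>j \<le> R I\<close>.
\<close>

lemma commuting_compression_bound:
  fixes T B :: mat_tuple
  assumes T: "T \<in> sym_tuples g m" and comm: "commuting_tuple g T" and B: "B \<in> sym_tuples g n"
    and V: "V \<in> carrier_mat m n"
    and bound: "\<And>t y. t \<in> joint_spectrum g m T \<Longrightarrow>
                  (\<Sum>j<g. t j * qform n (B j) y) \<le> R * (\<Sum>k<n. (y k)\<^sup>2)"
  shows "(\<Sum>j<g. \<Sum>k<n. \<Sum>l<n. B j $$ (k, l) * (transpose_mat V * T j * V) $$ (k, l))
       \<le> R * (\<Sum>i<m. \<Sum>k<n. (V $$ (i, k))\<^sup>2)"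
proof -
  have Tc: "T j \<in> carrier_mat m m" if "j < g" for j
    using T that by (auto simp: sym_tuples_def sym_mats_def)
  have Tsym: "T j $$ (i, k) = T j $$ (k, i)" if "j < g" "i < m" "k < m" for i j k
    using T that sym_mats_entry by (auto simp: sym_tuples_def)
  have Bsym: "B j $$ (i, k) = B j $$ (k, i)" if "j < g" "i < n" "k < n" for i j k
    using B that sym_mats_entry by (auto simp: sym_tuples_def)
  have Tcomm: "(\<Sum>p<m. T j $$ (i, p) * T l $$ (p, k)) = (\<Sum>p<m. T l $$ (i, p) * T j $$ (p, k))"
    if "j < g" "l < g" "i < m" "k < m" for i j k l
  proof -
    have "(T j * T l) $$ (i, k) = (T l * T j) $$ (i, k)"
      using comm that by (simp add: commuting_tuple_def)
    then show ?thesis using that by (simp only: mult_entry[OF Tc Tc])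
  qed
  define I where "I = {..<m} \<times> {..<n}"
  have nested: "(\<Sum>p\<in>I. F p) = (\<Sum>i<m. \<Sum>k<n. F (i, k))" for F :: "nat \<times> nat \<Rightarrow> real"
    by (simp add: I_def sum.cartesian_product)
  \<comment> \<open>Index \<open>0\<close> is the operator \<open>Z \<mapsto> \<Sum>\<^sub>j T\<^sub>j Z B\<^sub>j\<close> to be bounded, index \<open>Suc j\<close> is \<open>Z \<mapsto> T\<^sub>j Z\<close>.\<close>
  define a where "a j p q = (case j of
      0 \<Rightarrow> (\<Sum>j<g. T j $$ (fst p, fst q) * B j $$ (snd p, snd q))
    | Suc j \<Rightarrow> T j $$ (fst p, fst q) * (if snd p = snd q then 1 else 0))" for j and p q :: "nat \<times> nat"
  have a0: "a 0 (i, k) (i', k') = (\<Sum>j<g. T j $$ (i, i') * B j $$ (k, k'))" for i k i' k'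
    by (simp add: a_def)
  have aS: "a (Suc j) (i, k) (i', k') = T j $$ (i, i') * (if k = k' then 1 else 0)" for j i k i' k'
    by (simp add: a_def)
  show ?thesis
  proof (cases "I = {}")
    case True
    then have "n = 0 \<or> m = 0" by (auto simp: I_def)
    then show ?thesis
    proof
      assume "m = 0"
      then have "(transpose_mat V * T j * V) $$ (k, l) = 0" if "k < n" "l < n" "j < g" for j k l
        using compression_entry[OF Tc V] that by (simp add: bform_def)
      then show ?thesis using \<open>m = 0\<close> by simp
    qed simp
  next
    case False
    have c0: "(\<Sum>p\<in>I. a 0 x p * a (Suc l) p y) = (\<Sum>p\<in>I. a (Suc l) x p * a 0 p y)"
      if "l < g" and xy: "x \<in> I" "y \<in> I" for l x y
    proof -
      obtain i k i' k' where [simp]: "x = (i, k)" "y = (i', k')" by (cases x, cases y)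
      have b: "i < m" "k < n" "i' < m" "k' < n" using xy by (auto simp: I_def)
      have "(\<Sum>p\<in>I. a 0 x p * a (Suc l) p y)
          = (\<Sum>r<m. \<Sum>s<n. if s = k' then a 0 (i, k) (r, s) * T l $$ (r, i') else 0)"
        unfolding nested by (intro sum.cong refl) (simp add: aS)
      also have "\<dots> = (\<Sum>r<m. a 0 (i, k) (r, k') * T l $$ (r, i'))"
        using b by simp
      also have "\<dots> = (\<Sum>j<g. (\<Sum>r<m. T j $$ (i, r) * T l $$ (r, i')) * B j $$ (k, k'))"
        unfolding a0 sum_distrib_right by (subst sum.swap) (simp add: algebra_simps)
      also have "\<dots> = (\<Sum>j<g. (\<Sum>r<m. T l $$ (i, r) * T j $$ (r, i')) * B j $$ (k, k'))"
        using that b by (intro sum.cong refl) (simp add: Tcomm)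
      also have "\<dots> = (\<Sum>r<m. T l $$ (i, r) * a 0 (r, k) (i', k'))"
        unfolding a0 sum_distrib_right sum_distrib_left by (subst sum.swap) (simp add: algebra_simps)
      also have "\<dots> = (\<Sum>r<m. \<Sum>s<n. if s = k then T l $$ (i, r) * a 0 (r, s) (i', k') else 0)"
        using b by simp
      also have "\<dots> = (\<Sum>p\<in>I. a (Suc l) x p * a 0 p y)"
        unfolding nested by (intro sum.cong refl) (auto simp: aS)
      finally show ?thesis .
    qed
    have cS: "(\<Sum>p\<in>I. a (Suc j) x p * a (Suc l) p y) = (\<Sum>p\<in>I. a (Suc l) x p * a (Suc j) p y)"
      if "j < g" "l < g" and xy: "x \<in> I" "y \<in> I" for j l x y
    proof -
      obtain i k i' k' where [simp]: "x = (i, k)" "y = (i', k')" by (cases x, cases y)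
      have b: "i < m" "k < n" "i' < m" "k' < n" using xy by (auto simp: I_def)
      have *: "(\<Sum>p\<in>I. a (Suc j) x p * a (Suc l) p y)
          = (\<Sum>r<m. T j $$ (i, r) * T l $$ (r, i')) * (if k = k' then 1 else 0)" for j l
      proof -
        have "(\<Sum>p\<in>I. a (Suc j) x p * a (Suc l) p y)
           = (\<Sum>r<m. \<Sum>s<n. if s = k then T j $$ (i, r) * T l $$ (r, i') * (if k = k' then 1 else 0) else 0)"
          unfolding nested by (intro sum.cong refl) (auto simp: aS)
        also have "\<dots> = (\<Sum>r<m. T j $$ (i, r) * T l $$ (r, i') * (if k = k' then 1 else 0))"
          using b by simp
        finally show ?thesis by (simp add: sum_distrib_right)
      qed
      show ?thesis unfolding * using that b by (simp add: Tcomm)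
    qed
    obtain z \<mu> where z0: "\<exists>p\<in>I. z p \<noteq> 0"
      and eig: "\<And>j x. j \<le> g \<Longrightarrow> x \<in> I \<Longrightarrow> (\<Sum>y\<in>I. a j x y * z y) = \<mu> j * z x"
      and max: "\<And>f. kernel_form I (a 0) f f \<le> \<mu> 0 * (\<Sum>x\<in>I. (f x)\<^sup>2)"
    proof (rule joint_eigenvector[of I g a])
      show "finite I" by (simp add: I_def)
      show "I \<noteq> {}" by fact
      show "a j x y = a j y x" if "j \<le> g" "x \<in> I" "y \<in> I" for j x y
      proof -
        obtain i k i' k' where [simp]: "x = (i, k)" "y = (i', k')" by (cases x, cases y)
        have b: "i < m" "k < n" "i' < m" "k' < n" using that by (auto simp: I_def)
        show ?thesis
        proof (cases j)
          case 0
          then show ?thesis by (auto simp: a0 b Tsym[of _ i] Bsym[of _ k] intro!: sum.cong)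
        next
          case (Suc l)
          then show ?thesis using that b Tsym[of l i i'] by (simp add: aS)
        qed
      qed
      show "(\<Sum>p\<in>I. a j i p * a l p k) = (\<Sum>p\<in>I. a l i p * a j p k)"
        if "j \<le> g" "l \<le> g" "i \<in> I" "k \<in> I" for j l i k
        using that c0 cS by (cases j; cases l) auto
    qed (rule that)
    define t where "t j = \<mu> (Suc j)" for j
    have col: "(\<Sum>i'<m. T j $$ (i, i') * z (i', k)) = t j * z (i, k)" if "j < g" "i < m" "k < n" for j i k
    proof -
      have "(\<Sum>i'<m. T j $$ (i, i') * z (i', k))
          = (\<Sum>i'<m. \<Sum>k'<n. if k' = k then T j $$ (i, i') * z (i', k') else 0)"
        using that by simp
      also have "\<dots> = (\<Sum>y\<in>I. a (Suc j) (i, k) y * z y)"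
        unfolding nested by (intro sum.cong refl) (auto simp: aS)
      also have "\<dots> = t j * z (i, k)" using eig[of "Suc j" "(i, k)"] that by (simp add: I_def t_def)
      finally show ?thesis .
    qed
    obtain i0 k0 where "i0 < m" "k0 < n" "z (i0, k0) \<noteq> 0" using z0 by (auto simp: I_def)
    then have t: "t \<in> joint_spectrum g m T"
      using Tc col by (intro joint_spectrumI[of g T m "\<lambda>i. z (i, k0)" t i0]) auto
    have row: "z (i, k) * (\<mu> 0 * z (i, k))
        = (\<Sum>j<g. t j * (\<Sum>l<n. z (i, k) * B j $$ (k, l) * z (i, l)))" if "i < m" "k < n" for i k
    proof -
      have "\<mu> 0 * z (i, k) = (\<Sum>y\<in>I. a 0 (i, k) y * z y)" using eig[of 0 "(i, k)"] that by (simp add: I_def)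
      also have "\<dots> = (\<Sum>i'<m. \<Sum>l<n. \<Sum>j<g. T j $$ (i, i') * B j $$ (k, l) * z (i', l))"
        unfolding nested a0 sum_distrib_right ..
      also have "\<dots> = (\<Sum>l<n. \<Sum>i'<m. \<Sum>j<g. T j $$ (i, i') * B j $$ (k, l) * z (i', l))"
        by (rule sum.swap)
      also have "\<dots> = (\<Sum>l<n. \<Sum>j<g. \<Sum>i'<m. T j $$ (i, i') * B j $$ (k, l) * z (i', l))"
        by (intro sum.cong refl sum.swap)
      also have "\<dots> = (\<Sum>l<n. \<Sum>j<g. B j $$ (k, l) * (\<Sum>i'<m. T j $$ (i, i') * z (i', l)))"
        by (simp add: sum_distrib_left algebra_simps)
      also have "\<dots> = (\<Sum>l<n. \<Sum>j<g. B j $$ (k, l) * (t j * z (i, l)))"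
        using that by (intro sum.cong refl) (simp add: col)
      also have "\<dots> = (\<Sum>j<g. \<Sum>l<n. B j $$ (k, l) * (t j * z (i, l)))" by (rule sum.swap)
      finally show ?thesis by (simp add: sum_distrib_left algebra_simps)
    qed
    have "\<mu> 0 * (\<Sum>x\<in>I. (z x)\<^sup>2) = (\<Sum>i<m. \<Sum>k<n. z (i, k) * (\<mu> 0 * z (i, k)))"
      unfolding nested by (simp add: sum_distrib_left power2_eq_square algebra_simps)
    also have "\<dots> = (\<Sum>i<m. \<Sum>k<n. \<Sum>j<g. t j * (\<Sum>l<n. z (i, k) * B j $$ (k, l) * z (i, l)))"
      by (intro sum.cong refl) (simp add: row)
    also have "\<dots> = (\<Sum>i<m. \<Sum>j<g. t j * qform n (B j) (\<lambda>k. z (i, k)))"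
      unfolding bform_def sum_distrib_left by (intro sum.cong refl sum.swap)
    also have "\<dots> \<le> (\<Sum>i<m. R * (\<Sum>k<n. (z (i, k))\<^sup>2))"
      by (intro sum_mono bound t)
    also have "\<dots> = R * (\<Sum>x\<in>I. (z x)\<^sup>2)" by (simp add: nested sum_distrib_left)
    finally have "\<mu> 0 * (\<Sum>x\<in>I. (z x)\<^sup>2) \<le> R * (\<Sum>x\<in>I. (z x)\<^sup>2)" .
    moreover have "(\<Sum>x\<in>I. (z x)\<^sup>2) > 0"
      using z0 by (auto intro!: sum_pos2 simp: I_def)
    ultimately have "\<mu> 0 \<le> R" by simp
    have entry: "(transpose_mat V * T j * V) $$ (k, l) = (\<Sum>i<m. \<Sum>i'<m. V $$ (i, k) * T j $$ (i, i') * V $$ (i', l))"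
      if "j < g" "k < n" "l < n" for j k l using compression_entry[OF Tc V] that by (simp add: bform_def)
    \<comment> \<open>Summing over the pair \<open>(i, k)\<close>, then over \<open>(i', l)\<close> and last over \<open>j\<close> exhibits the form of \<open>a 0\<close> at \<open>V\<close>.\<close>
    have "(\<Sum>j<g. \<Sum>k<n. \<Sum>l<n. B j $$ (k, l) * (transpose_mat V * T j * V) $$ (k, l))
        = (\<Sum>j<g. \<Sum>k<n. \<Sum>l<n. \<Sum>i<m. \<Sum>i'<m. V $$ (i, k) * (T j $$ (i, i') * B j $$ (k, l) * V $$ (i', l)))"
      by (intro sum.cong refl) (simp add: entry sum_distrib_left algebra_simps)
    also have "\<dots> = (\<Sum>k<n. \<Sum>j<g. \<Sum>l<n. \<Sum>i<m. \<Sum>i'<m. V $$ (i, k) * (T j $$ (i, i') * B j $$ (k, l) * V $$ (i', l)))"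
      by (rule sum.swap)
    also have "\<dots> = (\<Sum>k<n. \<Sum>l<n. \<Sum>j<g. \<Sum>i<m. \<Sum>i'<m. V $$ (i, k) * (T j $$ (i, i') * B j $$ (k, l) * V $$ (i', l)))"
      by (intro sum.cong refl sum.swap)
    also have "\<dots> = (\<Sum>k<n. \<Sum>l<n. \<Sum>i<m. \<Sum>j<g. \<Sum>i'<m. V $$ (i, k) * (T j $$ (i, i') * B j $$ (k, l) * V $$ (i', l)))"
      by (intro sum.cong refl sum.swap)
    also have "\<dots> = (\<Sum>k<n. \<Sum>i<m. \<Sum>l<n. \<Sum>j<g. \<Sum>i'<m. V $$ (i, k) * (T j $$ (i, i') * B j $$ (k, l) * V $$ (i', l)))"
      by (intro sum.cong refl sum.swap)
    also have "\<dots> = (\<Sum>i<m. \<Sum>k<n. \<Sum>l<n. \<Sum>j<g. \<Sum>i'<m. V $$ (i, k) * (T j $$ (i, i') * B j $$ (k, l) * V $$ (i', l)))"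
      by (rule sum.swap)
    also have "\<dots> = (\<Sum>i<m. \<Sum>k<n. \<Sum>l<n. \<Sum>i'<m. \<Sum>j<g. V $$ (i, k) * (T j $$ (i, i') * B j $$ (k, l) * V $$ (i', l)))"
      by (intro sum.cong refl sum.swap)
    also have "\<dots> = (\<Sum>i<m. \<Sum>k<n. \<Sum>i'<m. \<Sum>l<n. \<Sum>j<g. V $$ (i, k) * (T j $$ (i, i') * B j $$ (k, l) * V $$ (i', l)))"
      by (intro sum.cong refl sum.swap)
    also have "\<dots> = kernel_form I (a 0) (\<lambda>p. V $$ p) (\<lambda>p. V $$ p)"
      unfolding kernel_form_def nested a0 by (simp add: sum_distrib_left sum_distrib_right)
    also have "\<dots> \<le> \<mu> 0 * (\<Sum>x\<in>I. (V $$ x)\<^sup>2)" by (rule max)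
    also have "\<dots> \<le> R * (\<Sum>x\<in>I. (V $$ x)\<^sup>2)"
      using \<open>\<mu> 0 \<le> R\<close> by (intro mult_right_mono sum_nonneg) auto
    finally show ?thesis unfolding nested .
  qed
qed

section \<open>The pencil as a quadratic form\<close>

lemma sum_product_index:
  fixes f :: "nat \<Rightarrow> real"
  shows "(\<Sum>R<d * n. f R) = (\<Sum>r<d. \<Sum>p<n. f (r * n + p))"
proof -
  have "(\<Sum>R<d * n. f R) = (\<Sum>r<d. \<Sum>R\<in>{r * n..<r * n + n}. f R)" by (rule sum.nat_group[symmetric])
  moreover have "(\<Sum>R\<in>{r * n..<r * n + n}. f R) = (\<Sum>p<n. f (r * n + p))" for r
    using sum.shift_bounds_nat_ivl[of f 0 "r * n" n] by (simp add: add.commute atLeast0LessThan)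
  ultimately show ?thesis by simp
qed

lemma product_index:
  fixes n p r d :: nat
  assumes "p < n" 
  shows "(r * n + p) div n = r" "(r * n + p) mod n = p" "r < d \<Longrightarrow> r * n + p < d * n"
    "p' < n \<Longrightarrow> r * n + p = r' * n + p' \<longleftrightarrow> r = r' \<and> p = p'"
proof -
  show 1: "(r * n + p) div n = r" "(r * n + p) mod n = p" using assms by auto
  show "r * n + p < d * n" if "r < d"
  proof -
    have "r * n + p < Suc r * n" using assms by simp
    also have "\<dots> \<le> d * n" using that by (intro mult_right_mono) auto
    finally show ?thesis .
  qed
  show "r * n + p = r' * n + p' \<longleftrightarrow> r = r' \<and> p = p'" if "p' < n"
    using assms that 1 by (metis add.commute div_mult_self3 div_less add_0_right mod_mult_self3 mod_less not_less_zero)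
qed

text \<open>
  The quadratic form of the pencil at a vector whose \<open>(r, p)\<close> entry is \<open>w r p\<close>, where \<open>r\<close> belongs to the
  coefficients \<open>A\<close> and \<open>p\<close> to the arguments \<open>X\<close>. Stated for functions of two indices, it avoids the
  \<open>div\<close> and \<open>mod\<close> of the Kronecker product.
\<close>

definition pencil_form :: "nat \<Rightarrow> nat \<Rightarrow> mat_tuple \<Rightarrow> nat \<Rightarrow> mat_tuple \<Rightarrow> (nat \<Rightarrow> nat \<Rightarrow> real) \<Rightarrow> real" where
  "pencil_form g d A n X w = (\<Sum>r<d. \<Sum>p<n. (w r p)\<^sup>2)
     - (\<Sum>j<g. \<Sum>r<d. \<Sum>r'<d. A j $$ (r, r') * bform n (X j) (w r) (w r'))"

lemma vec_form:
  assumes "M \<in> carrier_mat n n"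
  shows "vec n y \<bullet> (M *\<^sub>v vec n y) = qform n M y"
proof -
  have "vec n y \<bullet> (M *\<^sub>v vec n y) = (\<Sum>i<n. y i * (M *\<^sub>v vec n y) $ i)"
    using assms by (simp add: scalar_prod_def atLeast0LessThan)
  also have "\<dots> = (\<Sum>i<n. y i * (\<Sum>k<n. M $$ (i, k) * y k))"
    by (intro sum.cong refl) (simp add: mult_vec_entry[OF assms] del: index_mult_mat_vec)
  finally show ?thesis by (simp add: bform_def sum_distrib_left mult.assoc)
qed

lemma psd_iff_qform:
  "psd n M \<longleftrightarrow> M \<in> sym_mats n \<and> (\<forall>y. qform n M y \<ge> 0)"
proof (cases "M \<in> sym_mats n")
  case True
  then have M: "M \<in> carrier_mat n n" by (simp add: sym_mats_def)
  have "(\<forall>v\<in>carrier_vec n. v \<bullet> (M *\<^sub>v v) \<ge> 0) \<longleftrightarrow> (\<forall>y. vec n y \<bullet> (M *\<^sub>v vec n y) \<ge> 0)"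
    by (metis vec_carrier dim_vec vec_carrier_vec carrier_vecD eq_vecI index_vec)
  then show ?thesis using True by (simp add: psd_def vec_form[OF M])
qed (simp add: psd_def)

lemma free_spectrahedron_iff:
  assumes A: "A \<in> sym_tuples g d"
  shows "X \<in> free_spectrahedron g d A n
     \<longleftrightarrow> X \<in> sym_tuples g n \<and> (\<forall>w. pencil_form g d A n X w \<ge> 0)"
proof (cases "X \<in> sym_tuples g n")
  case True
  define L where "L = lin_pencil g d A n X"
  have Ac: "A j \<in> carrier_mat d d" and Xc: "X j \<in> carrier_mat n n" if "j < g" for j
    using A True that by (auto simp: sym_tuples_def sym_mats_def)
  have As: "A j $$ (r, s) = A j $$ (s, r)" if "j < g" "r < d" "s < d" for j r s
    using A that sym_mats_entry by (auto simp: sym_tuples_def)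
  have Xs: "X j $$ (r, s) = X j $$ (s, r)" if "j < g" "r < n" "s < n" for j r s
    using True that sym_mats_entry by (auto simp: sym_tuples_def)
  have entry: "L $$ (R, S) = (if R = S then 1 else 0)
      - (\<Sum>j<g. A j $$ (R div n, S div n) * X j $$ (R mod n, S mod n))"
    if "R < d * n" "S < d * n" for R S
  proof -
    have "dim_row (A j) = d" "dim_col (A j) = d" "dim_row (X j) = n" "dim_col (X j) = n" if "j < g" for j
      using Ac[OF that] Xc[OF that] by auto
    then show ?thesis using that
      by (simp add: L_def lin_pencil_def tuple_sum_def kronecker_def)
  qed
  have Lc: "L \<in> carrier_mat (d * n) (d * n)" by (simp add: L_def lin_pencil_def tuple_sum_def minus_carrier_mat)
  have "L $$ (R, S) = L $$ (S, R)" if "R < d * n" "S < d * n" for R S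
  proof -
    have "n > 0" using that by (cases n) auto
    then have "R div n < d" "S div n < d" "R mod n < n" "S mod n < n"
      using that by (auto simp: less_mult_imp_div_less)
    then show ?thesis using that by (auto simp: entry As Xs intro!: sum.cong)
  qed
  then have Lsym: "L \<in> sym_mats (d * n)" using Lc by (auto simp: sym_mats_def intro!: eq_matI)
  have "qform (d * n) L y = pencil_form g d A n X (\<lambda>r p. y (r * n + p))" for y
  proof -
    let ?w = "\<lambda>r p. y (r * n + p)"
    have "qform (d * n) L y = (\<Sum>r<d. \<Sum>p<n. \<Sum>r'<d. \<Sum>p'<n. ?w r p * L $$ (r * n + p, r' * n + p') * ?w r' p')"
      by (simp add: bform_def sum_product_index)
    also have "\<dots> = (\<Sum>r<d. \<Sum>p<n. \<Sum>r'<d. \<Sum>p'<n. (if r' = r then if p' = p then ?w r p * ?w r' p' else 0 else 0)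
        - (\<Sum>j<g. A j $$ (r, r') * (?w r p * X j $$ (p, p') * ?w r' p')))"
    proof (intro sum.cong refl)
      fix r p r' p' assume "r \<in> {..<d}" "p \<in> {..<n}" "r' \<in> {..<d}" "p' \<in> {..<n}"
      then have b: "r < d" "p < n" "r' < d" "p' < n" by auto
      have e: "L $$ (r * n + p, r' * n + p')
          = (if r = r' \<and> p = p' then 1 else 0) - (\<Sum>j<g. A j $$ (r, r') * X j $$ (p, p'))"
        unfolding entry[OF product_index(3)[OF b(2,1)] product_index(3)[OF b(4,3)]]
          product_index(1,2)[OF b(2)] product_index(1,2)[OF b(4)] product_index(4)[OF b(2,4)] ..
      show "?w r p * L $$ (r * n + p, r' * n + p') * ?w r' p' =
          (if r' = r then if p' = p then ?w r p * ?w r' p' else 0 else 0)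
          - (\<Sum>j<g. A j $$ (r, r') * (?w r p * X j $$ (p, p') * ?w r' p'))"
        unfolding e by (simp add: sum_distrib_left sum_distrib_right algebra_simps)
    qed
    also have "\<dots> = (\<Sum>r<d. \<Sum>p<n. \<Sum>r'<d. \<Sum>p'<n. (if r' = r then if p' = p then ?w r p * ?w r' p' else 0 else 0))
        - (\<Sum>r<d. \<Sum>p<n. \<Sum>r'<d. \<Sum>p'<n. \<Sum>j<g. A j $$ (r, r') * (?w r p * X j $$ (p, p') * ?w r' p'))"
      by (simp only: sum_subtractf)
    also have "(\<Sum>r<d. \<Sum>p<n. \<Sum>r'<d. \<Sum>p'<n. (if r' = r then if p' = p then ?w r p * ?w r' p' else 0 else 0))
        = (\<Sum>r<d. \<Sum>p<n. (?w r p)\<^sup>2)"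
    proof (intro sum.cong refl)
      fix r p assume "r \<in> {..<d}" "p \<in> {..<n}"
      have "(\<Sum>r'<d. \<Sum>p'<n. (if r' = r then if p' = p then ?w r p * ?w r' p' else 0 else 0))
          = (\<Sum>r'<d. if r' = r then (\<Sum>p'<n. if p' = p then ?w r p * ?w r' p' else 0) else 0)"
        by (intro sum.cong refl) simp
      also have "\<dots> = (?w r p)\<^sup>2"
        using \<open>r \<in> {..<d}\<close> \<open>p \<in> {..<n}\<close> by (simp add: power2_eq_square)
      finally show "(\<Sum>r'<d. \<Sum>p'<n. (if r' = r then if p' = p then ?w r p * ?w r' p' else 0 else 0)) = (?w r p)\<^sup>2" .
    qed
    also have "(\<Sum>r<d. \<Sum>p<n. \<Sum>r'<d. \<Sum>p'<n. \<Sum>j<g. A j $$ (r, r') * (?w r p * X j $$ (p, p') * ?w r' p'))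
        = (\<Sum>j<g. \<Sum>r<d. \<Sum>r'<d. A j $$ (r, r') * bform n (X j) (?w r) (?w r'))"
    proof -
      have "(\<Sum>r<d. \<Sum>p<n. \<Sum>r'<d. \<Sum>p'<n. \<Sum>j<g. A j $$ (r, r') * (?w r p * X j $$ (p, p') * ?w r' p'))
          = (\<Sum>r<d. \<Sum>r'<d. \<Sum>p<n. \<Sum>p'<n. \<Sum>j<g. A j $$ (r, r') * (?w r p * X j $$ (p, p') * ?w r' p'))"
        by (intro sum.cong refl sum.swap)
      also have "\<dots> = (\<Sum>r<d. \<Sum>r'<d. \<Sum>p<n. \<Sum>j<g. \<Sum>p'<n. A j $$ (r, r') * (?w r p * X j $$ (p, p') * ?w r' p'))"
        by (intro sum.cong refl sum.swap)
      also have "\<dots> = (\<Sum>r<d. \<Sum>r'<d. \<Sum>j<g. \<Sum>p<n. \<Sum>p'<n. A j $$ (r, r') * (?w r p * X j $$ (p, p') * ?w r' p'))"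
        by (intro sum.cong refl sum.swap)
      also have "\<dots> = (\<Sum>r<d. \<Sum>j<g. \<Sum>r'<d. \<Sum>p<n. \<Sum>p'<n. A j $$ (r, r') * (?w r p * X j $$ (p, p') * ?w r' p'))"
        by (intro sum.cong refl sum.swap)
      also have "\<dots> = (\<Sum>j<g. \<Sum>r<d. \<Sum>r'<d. \<Sum>p<n. \<Sum>p'<n. A j $$ (r, r') * (?w r p * X j $$ (p, p') * ?w r' p'))"
        by (rule sum.swap)
      finally show ?thesis by (simp add: bform_def sum_distrib_left)
    qed
    finally show ?thesis by (simp add: pencil_form_def)
  qed
  moreover have "\<exists>y. pencil_form g d A n X w = pencil_form g d A n X (\<lambda>r p. y (r * n + p))" for w
    by (intro exI[of _ "\<lambda>R. w (R div n) (R mod n)"])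
       (simp add: pencil_form_def bform_def product_index)
  ultimately have "(\<forall>y. qform (d * n) L y \<ge> 0) \<longleftrightarrow> (\<forall>w. pencil_form g d A n X w \<ge> 0)" by metis
  then show ?thesis
    using True Lsym by (simp add: free_spectrahedron_def psd_iff_qform L_def)
qed (simp add: free_spectrahedron_def)

text \<open>
  On \<open>y \<otimes> v\<close>, with \<open>v\<close> a joint eigenvector for \<open>t\<close>, the pencil of \<open>T\<close> takes \<open>|v|\<^sup>2\<close> times the value of the
  scalar pencil at \<open>y\<close>.
\<close>

lemma joint_spectrum_in_free_spectrahedron:
  assumes A: "A \<in> sym_tuples g d" and T: "T \<in> free_spectrahedron g d A m"
    and t: "t \<in> joint_spectrum g m T"
  shows "scalar_tuple t \<in> free_spectrahedron g d A 1"
proof -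
  have Tc: "T j \<in> carrier_mat m m" if "j < g" for j
    using T that by (auto simp: free_spectrahedron_iff[OF A] sym_tuples_def sym_mats_def)
  obtain v where v: "v \<in> carrier_vec m" "v \<noteq> 0\<^sub>v m" and eig: "\<And>j. j < g \<Longrightarrow> T j *\<^sub>v v = t j \<cdot>\<^sub>v v"
    using t by (auto simp: joint_spectrum_def)
  define x where "x i = v $ i" for i
  have vx: "v = vec m x" using v(1) by (auto simp: x_def)
  define N where "N = (\<Sum>p<m. (x p)\<^sup>2)"
  obtain p0 where "p0 < m" "x p0 \<noteq> 0"
    using v by (auto simp: x_def vec_eq_iff)
  then have "N > 0" unfolding N_def by (intro sum_pos2[of _ p0]) auto
  have bT: "bform m (T j) (\<lambda>p. a * x p) (\<lambda>p. b * x p) = N * (a * t j * b)" if "j < g" for j a b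
  proof -
    have "(\<Sum>q<m. T j $$ (p, q) * x q) = t j * x p" if "p < m" for p
      using arg_cong[OF eig[OF \<open>j < g\<close>], of "\<lambda>u. u $ p"] that
        mult_vec_entry[OF Tc[OF \<open>j < g\<close>] that, of x] unfolding vx by simp
    then have "(\<Sum>p<m. (a * b * x p) * (\<Sum>q<m. T j $$ (p, q) * x q)) = (\<Sum>p<m. (a * b * x p) * (t j * x p))"
      by (intro sum.cong refl) simp
    then show ?thesis
      unfolding bform_def N_def by (simp add: sum_distrib_left sum_distrib_right power2_eq_square algebra_simps)
  qed
  have "pencil_form g d A 1 (scalar_tuple t) w \<ge> 0" for w
  proof -
    have "0 \<le> pencil_form g d A m T (\<lambda>r p. w r 0 * x p)"
      using T free_spectrahedron_iff[OF A] by blast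
    also have "\<dots> = N * (\<Sum>r<d. (w r 0)\<^sup>2) - (\<Sum>j<g. \<Sum>r<d. \<Sum>r'<d. A j $$ (r, r') * (N * (w r 0 * t j * w r' 0)))"
      unfolding pencil_form_def
      by (simp add: bT) (simp add: power_mult_distrib N_def sum_distrib_left sum_distrib_right mult.commute)
    also have "\<dots> = N * pencil_form g d A 1 (scalar_tuple t) w"
      unfolding pencil_form_def bform_def by (simp add: scalar_tuple_def sum_distrib_left algebra_simps)
    finally show ?thesis using \<open>N > 0\<close> by (simp add: zero_le_mult_iff)
  qed
  then show ?thesis
    unfolding free_spectrahedron_iff[OF A]
    by (auto simp: sym_tuples_def sym_mats_def scalar_tuple_def intro!: eq_matI)
qed

section \<open>The commuting dilation\<close>

text \<open>
  The direct sum whose \<open>j\<close>-th of \<open>g\<close> diagonal blocks is \<open>C\<^sub>j\<close> and whose other blocks vanish, that is,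
  \<open>E\<^sub>j\<^sub>j \<otimes> C\<^sub>j\<close>.
\<close>

definition block_tuple :: "nat \<Rightarrow> nat \<Rightarrow> mat_tuple \<Rightarrow> mat_tuple" where
  "block_tuple g n C j = mat (g * n) (g * n)
     (\<lambda>(P, Q). if P div n = j \<and> Q div n = j then C j $$ (P mod n, Q mod n) else 0)"

lemma block_tuple_carrier: "block_tuple g n C j \<in> carrier_mat (g * n) (g * n)"
  by (simp add: block_tuple_def)

lemma block_tuple_bform:
  assumes "j < g"
  shows "bform (g * n) (block_tuple g n C j) x y
       = bform n (C j) (\<lambda>q. x (j * n + q)) (\<lambda>q. y (j * n + q))"
proof -
  have "bform (g * n) (block_tuple g n C j) x y
      = (\<Sum>i<g. \<Sum>p<n. \<Sum>i'<g. \<Sum>p'<n.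
           x (i * n + p) * block_tuple g n C j $$ (i * n + p, i' * n + p') * y (i' * n + p'))"
    by (simp add: bform_def sum_product_index)
  also have "\<dots> = (\<Sum>i<g. \<Sum>p<n. \<Sum>i'<g. if i' = j then
        (\<Sum>p'<n. if i = j then x (i * n + p) * C j $$ (p, p') * y (i' * n + p') else 0) else 0)"
  proof (intro sum.cong refl)
    fix i p i' assume "i \<in> {..<g}" "p \<in> {..<n}" "i' \<in> {..<g}"
    then have "x (i * n + p) * block_tuple g n C j $$ (i * n + p, i' * n + p') * y (i' * n + p')
        = (if i' = j then if i = j then x (i * n + p) * C j $$ (p, p') * y (i' * n + p') else 0 else 0)"
      if "p' < n" for p'
      using that product_index(3)[of p n i g] product_index(3)[of p' n i' g]
      by (simp add: block_tuple_def product_index(1,2))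
    then show "(\<Sum>p'<n. x (i * n + p) * block_tuple g n C j $$ (i * n + p, i' * n + p') * y (i' * n + p'))
        = (if i' = j then (\<Sum>p'<n. if i = j then x (i * n + p) * C j $$ (p, p') * y (i' * n + p') else 0) else 0)"
      by simp
  qed
  also have "\<dots> = (\<Sum>i<g. if i = j then
        (\<Sum>p<n. \<Sum>p'<n. x (i * n + p) * C j $$ (p, p') * y (j * n + p')) else 0)"
    using assms by (intro sum.cong refl) simp
  finally show ?thesis using assms by (simp add: bform_def)
qed

text \<open>
  The pencil form splits over the \<open>g\<close> blocks, and its part on the \<open>i\<close>-th block is the form of the
  \<open>i\<close>-th coordinate tuple of \<open>C\<close>.
\<close>

lemma block_tuple_in_free_spectrahedron:
  assumes A: "A \<in> sym_tuples g d" and C: "C \<in> free_spectrahedron g d A n"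
    and cc: "coord_closed g (free_spectrahedron g d A)"
  shows "block_tuple g n C \<in> free_spectrahedron g d A (g * n)"
proof -
  have Csym: "C j $$ (p, q) = C j $$ (q, p)" if "j < g" "p < n" "q < n" for j p q
    using C that sym_mats_entry by (auto simp: free_spectrahedron_def sym_tuples_def)
  have "block_tuple g n C j $$ (P, Q) = block_tuple g n C j $$ (Q, P)"
    if "j < g" "P < g * n" "Q < g * n" for j P Q
  proof -
    have "n > 0" using that by (cases n) auto
    then show ?thesis using that by (auto simp: block_tuple_def Csym)
  qed
  then have sym: "block_tuple g n C \<in> sym_tuples g (g * n)"
    using block_tuple_carrier by (auto simp: sym_tuples_def intro!: sym_matsI)
  have "pencil_form g d A (g * n) (block_tuple g n C) w \<ge> 0" for w
  proof -
    let ?w = "\<lambda>i r q. w r (i * n + q)"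
    have coord: "pencil_form g d A n (coord_tuple n i C) u = (\<Sum>r<d. \<Sum>p<n. (u r p)\<^sup>2)
        - (\<Sum>r<d. \<Sum>r'<d. A i $$ (r, r') * bform n (C i) (u r) (u r'))" if "i < g" for i u
    proof -
      have "bform n (coord_tuple n i C j) x y = (if j = i then bform n (C i) x y else 0)" for j x y
        by (simp add: coord_tuple_def bform_def)
      then have "(\<Sum>r<d. \<Sum>r'<d. A j $$ (r, r') * bform n (coord_tuple n i C j) (u r) (u r'))
          = (if j = i then \<Sum>r<d. \<Sum>r'<d. A i $$ (r, r') * bform n (C i) (u r) (u r') else 0)" for j
        by simp
      then show ?thesis using that by (simp add: pencil_form_def)
    qed
    have "(\<Sum>r<d. \<Sum>P<g * n. (w r P)\<^sup>2) = (\<Sum>i<g. \<Sum>r<d. \<Sum>q<n. (?w i r q)\<^sup>2)"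
      unfolding sum_product_index by (rule sum.swap)
    then have "pencil_form g d A (g * n) (block_tuple g n C) w
        = (\<Sum>i<g. pencil_form g d A n (coord_tuple n i C) (?w i))"
      unfolding pencil_form_def[of g d A "g * n"] by (simp add: block_tuple_bform coord sum_subtractf)
    also have "\<dots> \<ge> 0"
    proof (rule sum_nonneg)
      fix i assume "i \<in> {..<g}"
      then have "coord_tuple n i C \<in> free_spectrahedron g d A n"
        using cc C by (auto simp: coord_closed_def)
      then show "0 \<le> pencil_form g d A n (coord_tuple n i C) (?w i)"
        using free_spectrahedron_iff[OF A] by blast
    qed
    finally show ?thesis .
  qed
  then show ?thesis using sym free_spectrahedron_iff[OF A] by blast
qed

lemma block_tuple_commuting: "commuting_tuple g (block_tuple g n C)"
proof -
  have zero: "block_tuple g n C i * block_tuple g n C j = 0\<^sub>m (g * n) (g * n)" if "i \<noteq> j" for i j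
  proof (rule eq_matI)
    fix P Q assume "P < dim_row (0\<^sub>m (g * n) (g * n) :: real mat)" "Q < dim_col (0\<^sub>m (g * n) (g * n) :: real mat)"
    then have b: "P < g * n" "Q < g * n" by auto
    have "block_tuple g n C i $$ (P, R) * block_tuple g n C j $$ (R, Q) = 0" if "R < g * n" for R
      using b that \<open>i \<noteq> j\<close> by (simp add: block_tuple_def)
    then show "(block_tuple g n C i * block_tuple g n C j) $$ (P, Q) = 0\<^sub>m (g * n) (g * n) $$ (P, Q)"
      unfolding mult_entry[OF block_tuple_carrier block_tuple_carrier b]
      using b by (simp del: mult_eq_0_iff)
  qed (simp_all add: block_tuple_def)
  have "block_tuple g n C i * block_tuple g n C j = block_tuple g n C j * block_tuple g n C i" for i j
    by (cases "i = j") (simp_all add: zero)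
  then show ?thesis unfolding commuting_tuple_def by blast
qed

lemma dilates_to_block_tuple:
  assumes "g \<ge> 1" and C: "C \<in> sym_tuples g n"
  shows "dilates_to g n (g * n) C (scale_tuple (real g) (block_tuple g n C))"
proof -
  \<comment> \<open>The columns of \<open>V\<close> are normalised sums of \<open>g\<close> copies of a basis vector, one in each block.\<close>
  define V :: "real mat" where "V = mat (g * n) n (\<lambda>(P, q). if P mod n = q then 1 / sqrt g else 0)"
  have V: "V \<in> carrier_mat (g * n) n" by (simp add: V_def)
  have Ve: "V $$ (i * n + p, q) = (if p = q then 1 / sqrt g else 0)" if "i < g" "p < n" "q < n" for i p q
    using that product_index(3)[of p n i g] by (simp add: V_def product_index(2))
  have iso: "transpose_mat V * V = 1\<^sub>m n"
  proof (rule eq_matI)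
    fix k l assume "k < dim_row (1\<^sub>m n :: real mat)" "l < dim_col (1\<^sub>m n :: real mat)"
    then have b: "k < n" "l < n" by auto
    have "(transpose_mat V * V) $$ (k, l) = (\<Sum>P<g * n. V $$ (P, k) * V $$ (P, l))"
      using b V by (simp add: mult_entry[of _ n "g * n"] del: index_mult_mat(1))
    also have "\<dots> = (\<Sum>i<g. \<Sum>p<n. if p = k then if k = l then 1 / g else 0 else 0)"
      unfolding sum_product_index by (intro sum.cong refl) (use b in \<open>auto simp: Ve\<close>)
    also have "\<dots> = 1\<^sub>m n $$ (k, l)" using b \<open>g \<ge> 1\<close> by simp
    finally show "(transpose_mat V * V) $$ (k, l) = 1\<^sub>m n $$ (k, l)" .
  qed (use V in auto)
  have "C j = transpose_mat V * scale_tuple (real g) (block_tuple g n C) j * V" if "j < g" for j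
  proof (rule eq_matI)
    have Cc: "C j \<in> carrier_mat n n" using C that by (auto simp: sym_tuples_def sym_mats_def)
    then show "dim_row (C j) = dim_row (transpose_mat V * scale_tuple (real g) (block_tuple g n C) j * V)"
      "dim_col (C j) = dim_col (transpose_mat V * scale_tuple (real g) (block_tuple g n C) j * V)"
      using V by auto
    fix k l assume "k < dim_row (transpose_mat V * scale_tuple (real g) (block_tuple g n C) j * V)"
      "l < dim_col (transpose_mat V * scale_tuple (real g) (block_tuple g n C) j * V)"
    then have b: "k < n" "l < n" using V by auto
    have sc: "scale_tuple (real g) (block_tuple g n C) j \<in> carrier_mat (g * n) (g * n)"
      using block_tuple_carrier by (simp add: scale_tuple_def)
    have "(transpose_mat V * scale_tuple (real g) (block_tuple g n C) j * V) $$ (k, l)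
        = g * bform (g * n) (block_tuple g n C j) (\<lambda>P. V $$ (P, k)) (\<lambda>P. V $$ (P, l))"
      unfolding compression_entry[OF sc V b] bform_def
      using block_tuple_carrier[of g n C j]
      by (simp add: scale_tuple_def sum_distrib_left mult.assoc mult.left_commute)
    also have "bform (g * n) (block_tuple g n C j) (\<lambda>P. V $$ (P, k)) (\<lambda>P. V $$ (P, l))
        = (\<Sum>p<n. \<Sum>q<n. if q = l then if p = k then C j $$ (k, l) / g else 0 else 0)"
      unfolding block_tuple_bform[OF that] unfolding bform_def
      by (intro sum.cong refl) (use b that in \<open>auto simp: Ve\<close>)
    also have "g * \<dots> = C j $$ (k, l)" using b \<open>g \<ge> 1\<close> by simp
    finally show "C j $$ (k, l) = (transpose_mat V * scale_tuple (real g) (block_tuple g n C) j * V) $$ (k, l)" ..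
  qed
  then show ?thesis unfolding dilates_to_def using V iso by blast
qed

section \<open>Polyhedral free spectrahedra\<close>

lemma bform_eq_kernel_form: "bform n M x y = kernel_form {..<n} (\<lambda>k l. M $$ (k, l)) x y"
  by (simp add: bform_def kernel_form_def sum_distrib_left mult.assoc)

text \<open>
  A pencil controls the quadratic forms of the matrices, whereas boundedness is measured in operator norm;
  for a symmetric matrix polarisation passes from one to the other without loss in the constant.
\<close>

lemma eucl_norm_mult_le:
  assumes M: "M \<in> sym_mats n" and "N > 0" and bound: "\<And>y. \<bar>qform n M y\<bar> \<le> N * (\<Sum>k<n. (y k)\<^sup>2)"
    and v: "v \<in> carrier_vec n"
  shows "eucl_norm (M *\<^sub>v v) \<le> N * eucl_norm v"
proof -
  define x where "x i = v $ i" for i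
  have vx: "v = vec n x" using v by (auto simp: x_def)
  define u where "u i = (\<Sum>k<n. M $$ (i, k) * x k)" for i
  have Mc: "M \<in> carrier_mat n n" using M by (simp add: sym_mats_def)
  have Mu: "M *\<^sub>v v = vec n u"
    using Mc by (intro eq_vecI) (simp_all add: vx u_def mult_vec_entry[OF Mc] del: index_mult_mat_vec)
  have nrm: "eucl_norm (vec n y) = sqrt (\<Sum>k<n. (y k)\<^sup>2)" for y
    by (simp add: eucl_norm_def scalar_prod_def atLeast0LessThan power2_eq_square)
  define U X where "U = (\<Sum>k<n. (u k)\<^sup>2)" and "X = (\<Sum>k<n. (x k)\<^sup>2)"
  have ux: "bform n M u x = U"
    by (simp add: bform_def U_def u_def power2_eq_square sum_distrib_left mult.assoc)
  have expand: "qform n M (\<lambda>i. x i + t * u i) = qform n M x + t * (2 * U) + t\<^sup>2 * qform n M u" for t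
    unfolding ux[symmetric] bform_eq_kernel_form by (rule kernel_form_add_scale) (simp add: sym_mats_entry[OF M])
  have sq: "(\<Sum>i<n. (x i + t * u i)\<^sup>2) = X + t * (2 * (\<Sum>i<n. x i * u i)) + t\<^sup>2 * U" for t
    by (simp add: U_def X_def power2_eq_square algebra_simps sum.distrib sum_distrib_left)
  \<comment> \<open>Polarise the bound at \<open>x + u / N\<close> and \<open>x - u / N\<close>; this step length balances the two terms.\<close>
  have "qform n M (\<lambda>i. x i + (1 / N) * u i) - qform n M (\<lambda>i. x i + (- 1 / N) * u i)
      \<le> N * (\<Sum>i<n. (x i + (1 / N) * u i)\<^sup>2) + N * (\<Sum>i<n. (x i + (- 1 / N) * u i)\<^sup>2)"
    using bound[of "\<lambda>i. x i + (1 / N) * u i"] bound[of "\<lambda>i. x i + (- 1 / N) * u i"] by linarith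
  then have "4 * U / N \<le> 2 * N * X + 2 * U / N"
    unfolding expand sq using \<open>N > 0\<close> by (simp add: algebra_simps power2_eq_square)
  then have "U \<le> N\<^sup>2 * X" using \<open>N > 0\<close> by (simp add: field_simps power2_eq_square)
  then have "sqrt U \<le> sqrt (N\<^sup>2 * X)" by (rule real_sqrt_le_mono)
  then show ?thesis using \<open>N > 0\<close> unfolding Mu unfolding vx nrm by (simp add: U_def X_def real_sqrt_mult)
qed

definition diag_tuple :: "nat \<Rightarrow> (nat \<Rightarrow> nat \<Rightarrow> real) \<Rightarrow> mat_tuple" where
  "diag_tuple d s j = mat d d (\<lambda>(r, c). if r = c then s r j else 0)"

lemma diag_tuple_sym: "diag_tuple d s \<in> sym_tuples g d"
  by (auto simp: sym_tuples_def diag_tuple_def intro!: sym_matsI)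

text \<open>
  A diagonal pencil is a direct sum of scalar-coefficient inequalities \<open>\<Sum>\<^sub>j a\<^sub>j X\<^sub>j \<le> I\<close>, one for each
  diagonal position.
\<close>

lemma free_spectrahedron_diag_tuple:
  "X \<in> free_spectrahedron g d (diag_tuple d s) n \<longleftrightarrow> X \<in> sym_tuples g n \<and>
     (\<forall>r<d. \<forall>y. (\<Sum>j<g. s r j * qform n (X j) y) \<le> (\<Sum>p<n. (y p)\<^sup>2))"
proof -
  have pf: "pencil_form g d (diag_tuple d s) n X w
      = (\<Sum>r<d. (\<Sum>p<n. (w r p)\<^sup>2) - (\<Sum>j<g. s r j * qform n (X j) (w r)))" for w
  proof -
    have "(\<Sum>r<d. \<Sum>r'<d. diag_tuple d s j $$ (r, r') * bform n (X j) (w r) (w r'))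
        = (\<Sum>r<d. s r j * qform n (X j) (w r))" for j
    proof (intro sum.cong refl)
      fix r assume "r \<in> {..<d}"
      then have "(\<Sum>r'<d. diag_tuple d s j $$ (r, r') * bform n (X j) (w r) (w r'))
          = (\<Sum>r'<d. if r' = r then s r j * qform n (X j) (w r) else 0)"
        by (intro sum.cong refl) (auto simp: diag_tuple_def)
      then show "(\<Sum>r'<d. diag_tuple d s j $$ (r, r') * bform n (X j) (w r) (w r'))
          = s r j * qform n (X j) (w r)" using \<open>r \<in> {..<d}\<close> by simp
    qed
    then show ?thesis unfolding pencil_form_def sum_subtractf by (simp only: sum.swap[of _ "{..<d}" "{..<g}"])
  qed
  have "(\<forall>w. pencil_form g d (diag_tuple d s) n X w \<ge> 0) \<longleftrightarrow>
     (\<forall>r<d. \<forall>y. (\<Sum>j<g. s r j * qform n (X j) y) \<le> (\<Sum>p<n. (y p)\<^sup>2))" (is "?L \<longleftrightarrow> ?R")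
  proof
    assume ?L
    show ?R
    proof (intro allI impI)
      fix r0 and y :: "nat \<Rightarrow> real" assume "r0 < d"
      define w where "w r = (if r = r0 then y else (\<lambda>_. 0))" for r
      have "0 \<le> (\<Sum>r<d. if r = r0 then (\<Sum>p<n. (y p)\<^sup>2) - (\<Sum>j<g. s r0 j * qform n (X j) y) else 0)"
      proof -
        have "0 \<le> pencil_form g d (diag_tuple d s) n X w" using \<open>?L\<close> by blast
        also have "\<dots> = (\<Sum>r<d. if r = r0 then (\<Sum>p<n. (y p)\<^sup>2) - (\<Sum>j<g. s r0 j * qform n (X j) y) else 0)"
          unfolding pf by (intro sum.cong refl) (simp add: w_def bform_def)
        finally show ?thesis .
      qed
      then show "(\<Sum>j<g. s r0 j * qform n (X j) y) \<le> (\<Sum>p<n. (y p)\<^sup>2)" using \<open>r0 < d\<close> by simp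
    qed
  next
    assume ?R
    then show ?L unfolding pf by (auto intro!: sum_nonneg)
  qed
  then show ?thesis unfolding free_spectrahedron_iff[OF diag_tuple_sym] by simp
qed

lemma sum_single_coordinate:
  fixes f :: "nat \<Rightarrow> real"
  assumes "j < g"
  shows "(\<Sum>i<g. (if i = j then b else 0) * f i) = b * f j"
proof -
  have "(\<Sum>i<g. (if i = j then b else 0) * f i) = (\<Sum>i<g. if i = j then b * f j else 0)"
    by (intro sum.cong refl) simp
  then show ?thesis using assms by simp
qed

text \<open>
  Coordinate closedness of the spectrahedron cut out by the normals \<open>S\<close> is inherited from \<open>S\<close>: testing a coordinate tuple of
  \<open>C\<close> against \<open>a\<close> is testing \<open>C\<close> against a coordinate projection of \<open>a\<close>. The multiples \<open>c\<close> and
  \<open>- c'\<close> of the \<open>j\<close>-th unit vector bound \<open>X\<^sub>j\<close> from above and below.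
\<close>

lemma polyhedral_spectrahedron:
  fixes S :: "(nat \<Rightarrow> real) set"
  assumes "finite S" "c > 0" "c' > 0"
    and proj: "\<And>a j. a \<in> S \<Longrightarrow> j < g \<Longrightarrow> (\<lambda>i. if i = j then a j else 0) \<in> S"
    and ax: "\<And>j. j < g \<Longrightarrow> (\<lambda>i. if i = j then c else 0) \<in> S"
    and ax': "\<And>j. j < g \<Longrightarrow> (\<lambda>i. if i = j then - c' else 0) \<in> S"
  obtains d A where "A \<in> sym_tuples g d" "free_bounded g (free_spectrahedron g d A)"
    "coord_closed g (free_spectrahedron g d A)"
    "\<And>n X. X \<in> free_spectrahedron g d A n \<longleftrightarrow> X \<in> sym_tuples g n \<and>
       (\<forall>a\<in>S. \<forall>y. (\<Sum>j<g. a j * qform n (X j) y) \<le> (\<Sum>p<n. (y p)\<^sup>2))"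
proof -
  obtain s where s: "bij_betw s {0..<card S} S"
    using ex_bij_betw_nat_finite[OF \<open>finite S\<close>] by blast
  then have S: "a \<in> S \<longleftrightarrow> (\<exists>r<card S. a = s r)" for a
    by (metis atLeast0LessThan bij_betw_imp_surj_on image_iff lessThan_iff)
  define A where "A = diag_tuple (card S) s"
  define D where "D = free_spectrahedron g (card S) A"
  have D: "X \<in> D n \<longleftrightarrow> X \<in> sym_tuples g n \<and>
       (\<forall>a\<in>S. \<forall>y. (\<Sum>j<g. a j * qform n (X j) y) \<le> (\<Sum>p<n. (y p)\<^sup>2))" for X n
    unfolding D_def A_def free_spectrahedron_diag_tuple using S by auto
  have D_le: "(\<Sum>j<g. a j * qform n (X j) y) \<le> (\<Sum>p<n. (y p)\<^sup>2)" if "X \<in> D n" "a \<in> S" for X n a y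
    using that D by blast
  have "coord_closed g D"
    unfolding coord_closed_def
  proof (intro allI impI ballI)
    fix n C j assume C: "C \<in> D n" and j: "j < g"
    have "(\<Sum>i<g. a i * qform n (coord_tuple n j C i) y) \<le> (\<Sum>p<n. (y p)\<^sup>2)" if a: "a \<in> S" for a y
    proof -
      have "(\<Sum>i<g. a i * qform n (coord_tuple n j C i) y)
          = (\<Sum>i<g. (if i = j then a j else 0) * qform n (C i) y)"
        by (intro sum.cong refl) (simp add: coord_tuple_def bform_def)
      also have "\<dots> \<le> (\<Sum>p<n. (y p)\<^sup>2)" by (rule D_le[OF C proj[OF a j]])
      finally show ?thesis .
    qed
    moreover have "coord_tuple n j C \<in> sym_tuples g n"
      using C j D[of C n] by (auto simp: sym_tuples_def coord_tuple_def sym_mats_def)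
    ultimately show "coord_tuple n j C \<in> D n" using D by blast
  qed
  moreover have "free_bounded g D"
    unfolding free_bounded_def
  proof (intro exI[of _ "1 / c + 1 / c'"] allI ballI impI)
    fix n X j and v :: "real vec" assume X: "X \<in> D n" and j: "j < g" and v: "v \<in> carrier_vec n"
    have Xs: "X j \<in> sym_mats n" using X j D[of X n] by (auto simp: sym_tuples_def)
    have "\<bar>qform n (X j) y\<bar> \<le> (1 / c + 1 / c') * (\<Sum>k<n. (y k)\<^sup>2)" for y
    proof -
      have "c * qform n (X j) y \<le> (\<Sum>k<n. (y k)\<^sup>2)" "- c' * qform n (X j) y \<le> (\<Sum>k<n. (y k)\<^sup>2)"
        using D_le[OF X ax[OF j], of y] D_le[OF X ax'[OF j], of y] by (simp_all only: sum_single_coordinate[OF j])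
      then have "qform n (X j) y \<le> (1 / c) * (\<Sum>k<n. (y k)\<^sup>2)" "- qform n (X j) y \<le> (1 / c') * (\<Sum>k<n. (y k)\<^sup>2)"
        using \<open>c > 0\<close> \<open>c' > 0\<close> by (simp_all add: field_simps)
      moreover have "(1 / c) * (\<Sum>k<n. (y k)\<^sup>2) \<ge> 0" "(1 / c') * (\<Sum>k<n. (y k)\<^sup>2) \<ge> 0"
        using \<open>c > 0\<close> \<open>c' > 0\<close> by (simp_all add: sum_nonneg)
      ultimately show ?thesis unfolding distrib_right by linarith
    qed
    then show "eucl_norm (X j *\<^sub>v v) \<le> (1 / c + 1 / c') * eucl_norm v"
      using \<open>c > 0\<close> \<open>c' > 0\<close> v by (intro eucl_norm_mult_le[OF Xs]) (auto simp: add_pos_pos)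
  qed
  ultimately show ?thesis
    using that[of A "card S"] D diag_tuple_sym unfolding D_def A_def by blast
qed

text \<open>
  The normals are the points of the grid \<open>(1/N) \<int>\<^sup>g\<close> in the closed unit ball. A tuple obeying the norm
  inequality of the ball satisfies all of them. Conversely, a unit vector rounded towards the origin is one of the normals and has
  moved by at most \<open>1/N\<close> in each coordinate, so scalar points have norm at most \<open>N / (N - g)\<close>. That
  bound is stated without division so that it makes sense for all \<open>N\<close>.
\<close>

lemma ball_grid_spectrahedron:
  assumes "N \<ge> 1"
  obtains d A where "A \<in> sym_tuples g d" "free_bounded g (free_spectrahedron g d A)"
    "coord_closed g (free_spectrahedron g d A)"
    "\<And>n X. X \<in> sym_tuples g n \<Longrightarrow>
       \<forall>a y. (\<Sum>j<g. a j * qform n (X j) y) \<le> sqrt (\<Sum>j<g. (a j)\<^sup>2) * (\<Sum>p<n. (y p)\<^sup>2) \<Longrightarrow>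
       X \<in> free_spectrahedron g d A n"
    "\<And>t. scalar_tuple t \<in> free_spectrahedron g d A 1 \<Longrightarrow>
        sqrt (\<Sum>j<g. (t j)\<^sup>2) * (real N - real g) \<le> real N"
proof -
  define S :: "(nat \<Rightarrow> real) set" where "S = {a. (\<forall>i\<ge>g. a i = 0) \<and>
     (\<forall>i<g. \<exists>k::int. a i = of_int k / real N) \<and> (\<Sum>i<g. (a i)\<^sup>2) \<le> 1}"
  have N0: "real N > 0" using assms by simp
  have "finite S"
  proof (rule finite_subset)
    let ?G = "(\<lambda>k::int. of_int k / real N) ` {- int N..int N}"
    show "S \<subseteq> (\<lambda>h i. if i < g then h i else 0) ` (PiE {..<g} (\<lambda>_. ?G))"
    proof
      fix a assume a: "a \<in> S"
      have "a i \<in> ?G" if "i < g" for i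
      proof -
        obtain k :: int where k: "a i = of_int k / real N" using a \<open>i < g\<close> unfolding S_def by blast
        have "(a i)\<^sup>2 \<le> (\<Sum>i<g. (a i)\<^sup>2)" using that by (intro member_le_sum) auto
        also have "\<dots> \<le> 1" using a by (simp add: S_def)
        finally have "\<bar>a i\<bar> \<le> 1" by (simp add: abs_square_le_1)
        then have "\<bar>real_of_int k\<bar> \<le> real N" using N0 by (simp add: k field_simps)
        then have "k \<in> {- int N..int N}" by auto
        then show ?thesis using k by blast
      qed
      then have "restrict a {..<g} \<in> PiE {..<g} (\<lambda>_. ?G)" by auto
      moreover have "a = (\<lambda>i. if i < g then restrict a {..<g} i else 0)"
        using a by (auto simp: S_def)
      ultimately show "a \<in> (\<lambda>h i. if i < g then h i else 0) ` (PiE {..<g} (\<lambda>_. ?G))" by blast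
    qed
    show "finite ((\<lambda>h i. if i < g then h i else 0 :: real) ` (PiE {..<g} (\<lambda>_. ?G)))"
      by (intro finite_imageI finite_PiE) auto
  qed
  have axis: "(\<lambda>i. if i = j then b else 0) \<in> S" if "j < g" "\<exists>k::int. b = of_int k / real N" "b\<^sup>2 \<le> 1" for b j
  proof -
    have "(\<Sum>i<g. (if i = j then b else 0)\<^sup>2) = (\<Sum>i<g. if i = j then b\<^sup>2 else 0)"
      by (intro sum.cong refl) simp
    then show ?thesis using that by (auto simp: S_def intro: exI[of _ "0::int"])
  qed
  have one: "\<exists>k::int. 1 = of_int k / real N" "\<exists>k::int. - 1 = of_int k / real N"
    using N0 by (auto intro: exI[of _ "int N"] exI[of _ "- int N"])
  obtain d A where A: "A \<in> sym_tuples g d" "free_bounded g (free_spectrahedron g d A)"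
    "coord_closed g (free_spectrahedron g d A)"
    and iff: "\<And>n X. X \<in> free_spectrahedron g d A n \<longleftrightarrow> X \<in> sym_tuples g n \<and>
       (\<forall>a\<in>S. \<forall>y. (\<Sum>j<g. a j * qform n (X j) y) \<le> (\<Sum>p<n. (y p)\<^sup>2))"
  proof (rule polyhedral_spectrahedron[of S 1 1 g])
    show "(\<lambda>i. if i = j then a j else 0) \<in> S" if "a \<in> S" "j < g" for a j
    proof (rule axis)
      have "(a j)\<^sup>2 \<le> (\<Sum>i<g. (a i)\<^sup>2)" using that by (intro member_le_sum) auto
      then show "(a j)\<^sup>2 \<le> 1" using that by (simp add: S_def)
    qed (use that in \<open>auto simp: S_def\<close>)
  qed (use \<open>finite S\<close> axis one in auto)
  show ?thesis
  proof (rule that[OF A])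
    fix n X assume X: "X \<in> sym_tuples g n" and
      b: "\<forall>a y. (\<Sum>j<g. a j * qform n (X j) y) \<le> sqrt (\<Sum>j<g. (a j)\<^sup>2) * (\<Sum>p<n. (y p)\<^sup>2)"
    have "(\<Sum>j<g. a j * qform n (X j) y) \<le> (\<Sum>p<n. (y p)\<^sup>2)" if "a \<in> S" for a y
    proof -
      have "sqrt (\<Sum>j<g. (a j)\<^sup>2) \<le> 1" using that by (simp add: S_def)
      then have "sqrt (\<Sum>j<g. (a j)\<^sup>2) * (\<Sum>p<n. (y p)\<^sup>2) \<le> 1 * (\<Sum>p<n. (y p)\<^sup>2)"
        by (intro mult_right_mono sum_nonneg) auto
      then show ?thesis using b[rule_format, of a y] by simp
    qed
    then show "X \<in> free_spectrahedron g d A n" using X iff by blast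
  next
    fix t assume t: "scalar_tuple t \<in> free_spectrahedron g d A 1"
    have inS: "(\<Sum>j<g. a j * t j) \<le> 1" if "a \<in> S" for a
    proof -
      have "(\<Sum>j<g. a j * qform 1 (scalar_tuple t j) (\<lambda>_. 1)) \<le> (\<Sum>p<(1::nat). 1\<^sup>2)"
        using t that iff by blast
      then show ?thesis by (simp add: bform_def scalar_tuple_def)
    qed
    define r where "r = sqrt (\<Sum>j<g. (t j)\<^sup>2)"
    have "r \<ge> 0" by (simp add: r_def sum_nonneg)
    have r2: "r\<^sup>2 = (\<Sum>j<g. (t j)\<^sup>2)" by (simp add: r_def sum_nonneg)
    show "r * (real N - real g) \<le> real N"
    proof (cases "r = 0")
      case False
      then have "r > 0" using \<open>r \<ge> 0\<close> by simp
      \<comment> \<open>Round the unit vector \<open>t / r\<close> towards the origin, so that it stays in the ball.\<close>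
      define k where "k j = \<lfloor>real N * \<bar>t j\<bar> / r\<rfloor>" for j
      define a where "a j = (if j < g then of_int (if t j \<ge> 0 then k j else - k j) / real N else 0)" for j
      have k0: "real_of_int (k j) \<ge> 0" for j using \<open>r > 0\<close> by (simp add: k_def)
      have k1: "real_of_int (k j) \<le> real N * \<bar>t j\<bar> / r" for j by (simp add: k_def)
      have k2: "real_of_int (k j) \<ge> real N * \<bar>t j\<bar> / r - 1" for j unfolding k_def by linarith
      have abs_a: "\<bar>a j\<bar> = k j / N" if "j < g" for j using that k0[of j] N0 by (simp add: a_def)
      have "(a j)\<^sup>2 \<le> (t j)\<^sup>2 / r\<^sup>2" if "j < g" for j
      proof -
        have "\<bar>a j\<bar> \<le> \<bar>t j\<bar> / r" unfolding abs_a[OF that] using k1[of j] N0 by (simp add: field_simps)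
        then have "\<bar>a j\<bar>\<^sup>2 \<le> (\<bar>t j\<bar> / r)\<^sup>2" by (intro power_mono) auto
        then show ?thesis by (simp add: power_divide)
      qed
      then have "(\<Sum>j<g. (a j)\<^sup>2) \<le> (\<Sum>j<g. (t j)\<^sup>2 / r\<^sup>2)" by (intro sum_mono) auto
      also have "\<dots> = 1" using \<open>r > 0\<close> by (simp add: sum_divide_distrib[symmetric] r2[symmetric])
      finally have "a \<in> S" by (auto simp: S_def a_def)
      have tr: "\<bar>t j\<bar> \<le> r" if "j < g" for j
      proof -
        have "(t j)\<^sup>2 \<le> r\<^sup>2" unfolding r2 using that by (intro member_le_sum) auto
        then show ?thesis using \<open>r > 0\<close> by (simp add: abs_le_square_iff[symmetric])
      qed
      have "(t j)\<^sup>2 / r - r / N \<le> a j * t j" if "j < g" for j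
      proof -
        have "a j * t j = k j / N * \<bar>t j\<bar>" using that by (simp add: a_def)
        also have "\<dots> \<ge> (real N * \<bar>t j\<bar> / r - 1) / N * \<bar>t j\<bar>"
          using k2[of j] N0 by (intro mult_right_mono divide_right_mono) auto
        also have "(real N * \<bar>t j\<bar> / r - 1) / N * \<bar>t j\<bar> = (t j)\<^sup>2 / r - \<bar>t j\<bar> / N"
          using N0 by (simp add: field_simps power2_eq_square)
        finally have "(t j)\<^sup>2 / r - \<bar>t j\<bar> / N \<le> a j * t j" .
        moreover have "\<bar>t j\<bar> / N \<le> r / N" using tr[OF that] N0 by (simp add: divide_right_mono)
        ultimately show ?thesis by linarith
      qed
      then have "(\<Sum>j<g. (t j)\<^sup>2 / r - r / N) \<le> (\<Sum>j<g. a j * t j)" by (intro sum_mono) auto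
      also have "\<dots> \<le> 1" by (rule inS) fact
      also have "(\<Sum>j<g. (t j)\<^sup>2 / r - r / N) = r - g * r / N"
      proof -
        have "(\<Sum>j<g. (t j)\<^sup>2 / r) = r\<^sup>2 / r" by (simp add: sum_divide_distrib[symmetric] r2)
        also have "\<dots> = r" using \<open>r > 0\<close> by (simp add: power2_eq_square)
        finally show ?thesis by (simp add: sum_subtractf)
      qed
      finally show ?thesis using N0 by (simp add: field_simps)
    qed simp
  qed
qed

section \<open>Anticommuting symmetric involutions\<close>

lemma bform_mult:
  assumes M: "M \<in> sym_mats n" and N: "N \<in> carrier_mat n n"
  shows "bform n (M * N) x y
       = (\<Sum>k<n. (\<Sum>l<n. M $$ (k, l) * x l) * (\<Sum>l<n. N $$ (k, l) * y l))"
proof -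
  have Mc: "M \<in> carrier_mat n n" using M by (simp add: sym_mats_def)
  have "bform n (M * N) x y = (\<Sum>p<n. \<Sum>q<n. \<Sum>k<n. (M $$ (k, p) * x p) * (N $$ (k, q) * y q))"
    unfolding bform_def
  proof (intro sum.cong refl)
    fix p q assume "p \<in> {..<n}" "q \<in> {..<n}"
    then have "(M * N) $$ (p, q) = (\<Sum>k<n. M $$ (k, p) * N $$ (k, q))"
      by (simp add: mult_entry[OF Mc N] sym_mats_entry[OF M, of p] del: index_mult_mat(1))
    then show "x p * (M * N) $$ (p, q) * y q = (\<Sum>k<n. (M $$ (k, p) * x p) * (N $$ (k, q) * y q))"
      by (simp add: sum_distrib_left sum_distrib_right algebra_simps)
  qed
  also have "\<dots> = (\<Sum>p<n. \<Sum>k<n. \<Sum>q<n. (M $$ (k, p) * x p) * (N $$ (k, q) * y q))"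
    by (intro sum.cong refl sum.swap)
  also have "\<dots> = (\<Sum>k<n. \<Sum>p<n. \<Sum>q<n. (M $$ (k, p) * x p) * (N $$ (k, q) * y q))"
    by (rule sum.swap)
  finally show ?thesis by (simp only: sum_product)
qed

definition clifford_tuple :: "nat \<Rightarrow> nat \<Rightarrow> mat_tuple \<Rightarrow> bool" where
  "clifford_tuple g n F \<longleftrightarrow> F \<in> sym_tuples g n \<and>
     (\<forall>i<g. \<forall>j<g. F i * F j + F j * F i = (if i = j then 2 else 0) \<cdot>\<^sub>m 1\<^sub>m n)"

text \<open>
  The real recursion for Clifford generators: double the size, replace \<open>F\<^sub>j\<close> by \<open>F\<^sub>j \<oplus> - F\<^sub>j\<close> and add the
  flip of the two summands.
\<close>

lemma clifford_tuple_exists: "\<exists>n F. n > 0 \<and> clifford_tuple g n F"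
proof (induction g)
  case 0
  show ?case by (intro exI[of _ 1]) (simp add: clifford_tuple_def sym_tuples_def)
next
  case (Suc g)
  then obtain n F where n: "n > 0" and F: "clifford_tuple g n F" by blast
  have Fc: "F j \<in> carrier_mat n n" and Ft: "transpose_mat (F j) = F j" if "j < g" for j
    using F that by (auto simp: clifford_tuple_def sym_tuples_def sym_mats_def)
  define Z where "Z = (0\<^sub>m n n :: real mat)"
  define E where "E = (1\<^sub>m n :: real mat)"
  have Zc: "Z \<in> carrier_mat n n" and Ec: "E \<in> carrier_mat n n" by (auto simp: Z_def E_def)
  define G where "G j = (if j < g then four_block_mat (F j) Z Z (- F j) else four_block_mat Z E E Z)" for j
  have Gc: "G j \<in> carrier_mat (n + n) (n + n)" for j
    using Fc Zc Ec by (auto simp: G_def)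
  have "transpose_mat (G j) = G j" for j
    using Fc[of j] Ft[of j] transpose_four_block_mat[OF Fc Zc Zc, of j "- F j"]
      transpose_four_block_mat[OF Zc Ec Ec Zc]
    by (auto simp: G_def Z_def E_def transpose_uminus)
  then have "G \<in> sym_tuples (Suc g) (n + n)" using Gc by (auto simp: sym_tuples_def sym_mats_def)
  moreover have "G i * G j + G j * G i = (if i = j then 2 else 0) \<cdot>\<^sub>m 1\<^sub>m (n + n)"
    if "i < Suc g" "j < Suc g" for i j
  proof -
    have one: "1\<^sub>m (n + n) = four_block_mat E Z Z E" by (simp add: E_def Z_def)
    have minus_zero: "- 0\<^sub>m n n = (0\<^sub>m n n :: real mat)" by (rule eq_matI) auto
    have FF: "G i * G j = four_block_mat (F i * F j) Z Z (F i * F j)" if "i < g" "j < g" for i j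
    proof -
      note c = Fc[OF that(1)] Fc[OF that(2)]
      have m: "- F i \<in> carrier_mat n n" "- F j \<in> carrier_mat n n" using c by auto
      have "G i * G j = four_block_mat (F i * F j + Z * Z) (F i * Z + Z * - F j)
          (Z * F j + - F i * Z) (Z * Z + - F i * - F j)"
        using that mult_four_block_mat[OF c(1) Zc Zc m(1) c(2) Zc Zc m(2)] by (simp add: G_def)
      moreover have "- F i * - F j = F i * F j" using c by simp
      ultimately show ?thesis using c m minus_zero by (simp add: Z_def)
    qed
    have FE: "G i * G g = four_block_mat Z (F i) (- F i) Z" if "i < g" for i
    proof -
      have m: "- F i \<in> carrier_mat n n" using Fc[OF that] by auto
      have "G i * G g = four_block_mat (F i * Z + Z * E) (F i * E + Z * Z) (Z * Z + - F i * E) (Z * E + - F i * Z)"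
        using that mult_four_block_mat[OF Fc[OF that] Zc Zc m Zc Ec Ec Zc] by (simp add: G_def)
      then show ?thesis using Fc[OF that] m minus_zero by (simp add: Z_def E_def)
    qed
    have EF: "G g * G i = four_block_mat Z (- F i) (F i) Z" if "i < g" for i
    proof -
      have m: "- F i \<in> carrier_mat n n" using Fc[OF that] by auto
      have "G g * G i = four_block_mat (Z * F i + E * Z) (Z * Z + E * - F i) (E * F i + Z * Z) (E * Z + Z * - F i)"
        using that mult_four_block_mat[OF Zc Ec Ec Zc Fc[OF that] Zc Zc m] by (simp add: G_def)
      then show ?thesis using Fc[OF that] m minus_zero by (simp add: Z_def E_def)
    qed
    have EE: "G g * G g = four_block_mat E Z Z E"
    proof -
      have "G g * G g = four_block_mat (Z * Z + E * E) (Z * E + E * Z) (E * Z + Z * E) (E * E + Z * Z)"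
        using mult_four_block_mat[OF Zc Ec Ec Zc Zc Ec Ec Zc] by (simp add: G_def)
      then show ?thesis using minus_zero by (simp add: Z_def E_def)
    qed
    have zero: "F i + - F i = Z" "- F i + F i = Z" if "i < g" for i
      using Fc[OF that] by (auto simp: Z_def)
    have ZZ: "Z + Z = Z" by (simp add: Z_def)
    have null: "four_block_mat Z Z Z Z = 0 \<cdot>\<^sub>m 1\<^sub>m (n + n)" by (auto simp: Z_def)
    consider "i < g" "j < g" | "i < g" "j = g" | "i = g" "j < g" | "i = g" "j = g"
      using \<open>i < Suc g\<close> \<open>j < Suc g\<close> by linarith
    then show ?thesis
    proof cases
      case 1
      let ?c = "if i = j then 2 else 0 :: real"
      have c: "F i * F j + F j * F i = ?c \<cdot>\<^sub>m E"
        using F 1 by (simp add: clifford_tuple_def E_def)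
      have "G i * G j + G j * G i
          = four_block_mat (F i * F j + F j * F i) (Z + Z) (Z + Z) (F i * F j + F j * F i)"
        unfolding FF[OF 1] FF[OF 1(2,1)]
        by (rule add_four_block_mat) (use Fc 1 Zc in \<open>auto intro!: mult_carrier_mat[of _ n n _ n]\<close>)
      also have "\<dots> = four_block_mat (?c \<cdot>\<^sub>m E) (?c \<cdot>\<^sub>m Z) (?c \<cdot>\<^sub>m Z) (?c \<cdot>\<^sub>m E)"
        unfolding c by (simp add: Z_def)
      also have "\<dots> = ?c \<cdot>\<^sub>m 1\<^sub>m (n + n)"
        unfolding one by (rule smult_four_block_mat[symmetric]) (rule Ec Zc)+
      finally show ?thesis .
    next
      case 2
      have "G i * G j + G j * G i = four_block_mat (Z + Z) (F i + - F i) (- F i + F i) (Z + Z)"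
        unfolding 2(2) FE[OF 2(1)] EF[OF 2(1)]
        by (rule add_four_block_mat) (use Fc 2 Zc in auto)
      then show ?thesis using 2 null by (simp add: zero ZZ)
    next
      case 3
      have "G i * G j + G j * G i = four_block_mat (Z + Z) (- F j + F j) (F j + - F j) (Z + Z)"
        unfolding 3(1) FE[OF 3(2)] EF[OF 3(2)]
        by (rule add_four_block_mat) (use Fc 3 Zc in auto)
      then show ?thesis using 3 null by (simp add: zero ZZ)
    next
      case 4
      have "four_block_mat E Z Z E + four_block_mat E Z Z E = 2 \<cdot>\<^sub>m 1\<^sub>m (n + n)"
        unfolding one[symmetric] by (rule eq_matI) auto
      then show ?thesis using 4 by (simp add: EE)
    qed
  qed
  ultimately show ?case using n by (intro exI[of _ "n + n"] exI[of _ G]) (auto simp: clifford_tuple_def)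
qed

text \<open>
  The inner product of \<open>F\<^sub>i y\<close> and \<open>F\<^sub>j y\<close> is symmetric in \<open>i\<close> and \<open>j\<close>, hence half the form of the
  anticommutator at \<open>y\<close>.
\<close>

lemma clifford_images_orthogonal:
  assumes F: "clifford_tuple g n F" and ij: "i < g" "j < g"
  shows "(\<Sum>k<n. (\<Sum>l<n. F i $$ (k, l) * y l) * (\<Sum>l<n. F j $$ (k, l) * y l))
       = (if i = j then \<Sum>k<n. (y k)\<^sup>2 else 0)"
proof -
  have Fs: "F i \<in> sym_mats n" "F j \<in> sym_mats n" using F ij by (auto simp: clifford_tuple_def sym_tuples_def)
  then have Fc: "F i \<in> carrier_mat n n" "F j \<in> carrier_mat n n" by (auto simp: sym_mats_def)
  have "bform n (F i * F j) y y + bform n (F j * F i) y y = bform n (F i * F j + F j * F i) y y"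
    unfolding bform_def sum.distrib[symmetric]
    using Fc by (intro sum.cong refl) (simp add: algebra_simps del: index_mult_mat(1))
  also have "\<dots> = (\<Sum>k<n. \<Sum>l<n. if l = k then (if i = j then 2 else 0) * (y k)\<^sup>2 else 0)"
    using F ij unfolding bform_def clifford_tuple_def
    by (intro sum.cong refl) (auto simp: power2_eq_square)
  also have "\<dots> = 2 * (if i = j then \<Sum>k<n. (y k)\<^sup>2 else 0)"
    by (simp add: sum_distrib_left)
  finally show ?thesis
    unfolding bform_mult[OF Fs(1) Fc(2)] bform_mult[OF Fs(2) Fc(1)] by (simp add: mult.commute)
qed

text \<open>
  The vectors \<open>F\<^sub>j y\<close> are orthogonal of length \<open>|y|\<close>, so \<open>\<Sum>\<^sub>j t\<^sub>j F\<^sub>j y\<close> has length \<open>|t| |y|\<close>; conclude by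
  Cauchy-Schwarz.
\<close>

lemma clifford_norm_bound:
  assumes F: "clifford_tuple g n F"
  shows "(\<Sum>j<g. t j * qform n (F j) y) \<le> sqrt (\<Sum>j<g. (t j)\<^sup>2) * (\<Sum>k<n. (y k)\<^sup>2)"
proof -
  define r Y where "r = sqrt (\<Sum>j<g. (t j)\<^sup>2)" and "Y = (\<Sum>k<n. (y k)\<^sup>2)"
  define f where "f j k = (\<Sum>l<n. F j $$ (k, l) * y l)" for j k
  define u where "u k = (\<Sum>j<g. t j * f j k)" for k
  have r2: "r\<^sup>2 = (\<Sum>j<g. (t j)\<^sup>2)" and "r \<ge> 0" by (simp_all add: r_def sum_nonneg)
  have lhs: "(\<Sum>j<g. t j * qform n (F j) y) = (\<Sum>k<n. y k * u k)"
  proof -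
    have "(\<Sum>j<g. t j * qform n (F j) y) = (\<Sum>j<g. \<Sum>k<n. y k * (t j * f j k))"
      by (simp add: bform_def f_def sum_distrib_left algebra_simps)
    also have "\<dots> = (\<Sum>k<n. \<Sum>j<g. y k * (t j * f j k))" by (rule sum.swap)
    finally show ?thesis by (simp add: u_def sum_distrib_left)
  qed
  have "(\<Sum>k<n. (u k)\<^sup>2) = (\<Sum>k<n. \<Sum>i<g. \<Sum>j<g. t i * t j * (f i k * f j k))"
    by (simp add: u_def power2_eq_square sum_product algebra_simps)
  also have "\<dots> = (\<Sum>i<g. \<Sum>k<n. \<Sum>j<g. t i * t j * (f i k * f j k))" by (rule sum.swap)
  also have "\<dots> = (\<Sum>i<g. \<Sum>j<g. \<Sum>k<n. t i * t j * (f i k * f j k))" by (intro sum.cong refl sum.swap)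
  also have "\<dots> = (\<Sum>i<g. \<Sum>j<g. t i * t j * (\<Sum>k<n. f i k * f j k))" by (simp add: sum_distrib_left)
  also have "\<dots> = (\<Sum>i<g. \<Sum>j<g. if j = i then (t i)\<^sup>2 * Y else 0)"
    unfolding f_def using clifford_images_orthogonal[OF F] by (intro sum.cong refl) (auto simp: Y_def power2_eq_square)
  also have "\<dots> = r\<^sup>2 * Y" by (simp add: r2 sum_distrib_right)
  finally have uu: "(\<Sum>k<n. (u k)\<^sup>2) = r\<^sup>2 * Y" .
  show ?thesis
  proof (cases "r = 0")
    case True
    then have "\<forall>j<g. t j = 0" using r2 by (simp add: sum_nonneg_eq_0_iff)
    then show ?thesis by simp
  next
    case False
    have "0 \<le> (\<Sum>k<n. (u k - r * y k)\<^sup>2)" by (simp add: sum_nonneg)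
    also have "\<dots> = (\<Sum>k<n. (u k)\<^sup>2) + r\<^sup>2 * Y - 2 * r * (\<Sum>k<n. y k * u k)"
      by (simp add: Y_def power2_eq_square algebra_simps sum.distrib sum_subtractf sum_distrib_left)
    also have "\<dots> = 2 * r * (r * Y - (\<Sum>k<n. y k * u k))" unfolding uu by (simp add: power2_eq_square algebra_simps)
    finally have "r * Y - (\<Sum>k<n. y k * u k) \<ge> 0" using False \<open>r \<ge> 0\<close> by (simp add: zero_le_mult_iff)
    then show ?thesis unfolding lhs r_def[symmetric] Y_def[symmetric] by simp
  qed
qed

lemma clifford_frobenius_norm:
  assumes F: "clifford_tuple g n F" and "j < g"
  shows "(\<Sum>k<n. \<Sum>l<n. (F j $$ (k, l))\<^sup>2) = n"
proof -
  have "(\<Sum>k<n. (F j $$ (k, l))\<^sup>2) = 1" if "l < n" for l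
  proof -
    have "(\<Sum>k<n. (F j $$ (k, l))\<^sup>2) = (\<Sum>k<n. (\<Sum>q<n. F j $$ (k, q) * (if q = l then 1 else 0))\<^sup>2)"
      using that by (simp add: if_distrib[of "\<lambda>x. _ * x"] cong: if_cong)
    also have "\<dots> = (\<Sum>k<n. (if k = l then 1 else 0)\<^sup>2)"
      using clifford_images_orthogonal[OF F \<open>j < g\<close> \<open>j < g\<close>, of "\<lambda>q. if q = l then 1 else 0"]
      by (simp add: power2_eq_square)
    also have "\<dots> = 1" using that by (simp add: if_distrib[of "\<lambda>x. x\<^sup>2"] cong: if_cong)
    finally show ?thesis .
  qed
  then have "(\<Sum>l<n. \<Sum>k<n. (F j $$ (k, l))\<^sup>2) = n" by simp
  then show ?thesis by (subst sum.swap)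
qed

section \<open>Sharpness of the scale\<close>

lemma isometry_entries_square_sum:
  assumes V: "V \<in> carrier_mat m n" and iso: "transpose_mat V * V = 1\<^sub>m n"
  shows "(\<Sum>i<m. \<Sum>k<n. (V $$ (i, k))\<^sup>2) = real n"
proof -
  have "(\<Sum>i<m. (V $$ (i, k))\<^sup>2) = 1" if "k < n" for k
  proof -
    have "(transpose_mat V * V) $$ (k, k) = 1" using iso that by simp
    then show ?thesis
      using that V by (simp add: mult_entry[of _ n m] power2_eq_square del: index_mult_mat(1))
  qed
  then have "(\<Sum>k<n. \<Sum>i<m. (V $$ (i, k))\<^sup>2) = n" by simp
  then show ?thesis by (subst sum.swap)
qed

definition admissible_scale :: "nat \<Rightarrow> real \<Rightarrow> bool" where
  "admissible_scale g \<rho> \<longleftrightarrow> (\<forall>d A n X.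
        A \<in> sym_tuples g d \<longrightarrow>
        free_bounded g (free_spectrahedron g d A) \<longrightarrow>
        coord_closed g (free_spectrahedron g d A) \<longrightarrow>
        X \<in> free_spectrahedron g d A n \<longrightarrow>
        (\<exists>T \<in> sym_tuples g (g * n).
           commuting_tuple g T \<and> dilates_to g n (g * n) X (scale_tuple \<rho> T) \<and>
           (\<forall>l \<in> joint_spectrum g (g * n) T. scalar_tuple l \<in> free_spectrahedron g d A 1)))"

lemma admissible_scaleE:
  assumes "admissible_scale g \<rho>" "A \<in> sym_tuples g d" "free_bounded g (free_spectrahedron g d A)"
    "coord_closed g (free_spectrahedron g d A)" "X \<in> free_spectrahedron g d A n"
  obtains T V where "T \<in> sym_tuples g (g * n)" "commuting_tuple g T" "V \<in> carrier_mat (g * n) n"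
    "(\<Sum>i<g * n. \<Sum>k<n. (V $$ (i, k))\<^sup>2) = real n"
    "\<And>j k l. j < g \<Longrightarrow> k < n \<Longrightarrow> l < n \<Longrightarrow>
       X j $$ (k, l) = \<rho> * (transpose_mat V * T j * V) $$ (k, l)"
    "\<And>t. t \<in> joint_spectrum g (g * n) T \<Longrightarrow> scalar_tuple t \<in> free_spectrahedron g d A 1"
proof -
  have "\<exists>T \<in> sym_tuples g (g * n).
           commuting_tuple g T \<and> dilates_to g n (g * n) X (scale_tuple \<rho> T) \<and>
           (\<forall>l \<in> joint_spectrum g (g * n) T. scalar_tuple l \<in> free_spectrahedron g d A 1)"
    using assms unfolding admissible_scale_def by blast
  then obtain T V where T: "T \<in> sym_tuples g (g * n)" "commuting_tuple g T"
    and V: "V \<in> carrier_mat (g * n) n" "transpose_mat V * V = 1\<^sub>m n"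
    and dil: "\<And>j. j < g \<Longrightarrow> X j = transpose_mat V * scale_tuple \<rho> T j * V"
    and spec: "\<And>t. t \<in> joint_spectrum g (g * n) T \<Longrightarrow> scalar_tuple t \<in> free_spectrahedron g d A 1"
    unfolding dilates_to_def by blast
  have "X j $$ (k, l) = \<rho> * (transpose_mat V * T j * V) $$ (k, l)" if "j < g" "k < n" "l < n" for j k l
  proof -
    have Tc: "T j \<in> carrier_mat (g * n) (g * n)"
      using T that by (auto simp: sym_tuples_def sym_mats_def)
    then have sc: "scale_tuple \<rho> T j \<in> carrier_mat (g * n) (g * n)" by (simp add: scale_tuple_def)
    show ?thesis
      unfolding dil[OF that(1)] compression_entry[OF sc V(1) that(2,3)] compression_entry[OF Tc V(1) that(2,3)]
      using Tc by (simp add: bform_def scale_tuple_def sum_distrib_left mult.assoc mult.left_commute)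
  qed
  then show ?thesis by (rule that[OF T V(1) isometry_entries_square_sum[OF V] _ spec])
qed

text \<open>
  The scalar box \<open>[- 1, M]\<^sup>g\<close> contains a point with first coordinate \<open>M\<close>. If it
  dilates to \<open>\<rho> T\<close>, then \<open>M = \<rho> z\<close> for a compression \<open>z\<close> of \<open>T\<^sub>0\<close>. As \<open>z \<ge> - 1\<close>, a nonpositive \<open>\<rho>\<close>
  would force \<open>M \<le> - \<rho>\<close>, which \<open>M = 1 - \<rho>\<close> violates.
\<close>

lemma admissible_scale_pos:
  assumes "g \<ge> 1" and adm: "admissible_scale g \<rho>"
  shows "\<rho> > 0"
proof (rule ccontr)
  assume "\<not> \<rho> > 0"
  then have "\<rho> \<le> 0" by simp
  define M where "M = 1 - \<rho>"
  have "M > 0" using \<open>\<rho> \<le> 0\<close> by (simp add: M_def)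
  define S :: "(nat \<Rightarrow> real) set" where
    "S = (\<Union>j<g. (\<lambda>b i. if i = j then b else 0) ` {1 / M, - 1, 0})"
  have axis: "(\<lambda>i. if i = j then b else 0) \<in> S" if "j < g" "b \<in> {1 / M, - 1, 0}" for j b
    unfolding S_def using that by blast
  have S_cases: "\<exists>j<g. \<exists>b\<in>{1 / M, - 1, 0}. a = (\<lambda>i. if i = j then b else 0)" if "a \<in> S" for a
    using that unfolding S_def by blast
  obtain d A where A: "A \<in> sym_tuples g d" "free_bounded g (free_spectrahedron g d A)"
    "coord_closed g (free_spectrahedron g d A)"
    and iff: "\<And>n X. X \<in> free_spectrahedron g d A n \<longleftrightarrow> X \<in> sym_tuples g n \<and>
       (\<forall>a\<in>S. \<forall>y. (\<Sum>j<g. a j * qform n (X j) y) \<le> (\<Sum>p<n. (y p)\<^sup>2))"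
  proof (rule polyhedral_spectrahedron[of S "1 / M" 1 g])
    show "(\<lambda>i. if i = j then a j else 0) \<in> S" if "a \<in> S" "j < g" for a j
      using S_cases[OF \<open>a \<in> S\<close>] axis[OF \<open>j < g\<close>] by auto
  qed (use \<open>M > 0\<close> axis in \<open>auto simp: S_def\<close>)
  define X where "X = scalar_tuple (\<lambda>j. if j = 0 then M else 0)"
  have "X \<in> free_spectrahedron g d A 1"
    unfolding iff
  proof (intro conjI ballI allI)
    show "X \<in> sym_tuples g 1" by (auto simp: X_def scalar_tuple_def sym_tuples_def intro!: sym_matsI)
    fix a and y :: "nat \<Rightarrow> real" assume "a \<in> S"
    then obtain j b where j: "j < g" and b: "b \<in> {1 / M, - 1, 0}" and a: "a = (\<lambda>i. if i = j then b else 0)"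
      using S_cases by blast
    have "b * M \<le> 1" using b \<open>M > 0\<close> by auto
    then have "b * M * (y 0)\<^sup>2 \<le> 1 * (y 0)\<^sup>2" by (intro mult_right_mono) auto
    then show "(\<Sum>j<g. a j * qform 1 (X j) y) \<le> (\<Sum>p<1. (y p)\<^sup>2)"
      unfolding a sum_single_coordinate[OF j] by (simp add: X_def scalar_tuple_def bform_def power2_eq_square algebra_simps)
  qed
  then obtain T V where
    T: "T \<in> sym_tuples g (g * 1)" "commuting_tuple g T" and V: "V \<in> carrier_mat (g * 1) 1"
    "(\<Sum>i<g * 1. \<Sum>k<1. (V $$ (i, k))\<^sup>2) = real 1"
    and dil: "\<And>j k l. j < g \<Longrightarrow> k < 1 \<Longrightarrow> l < 1 \<Longrightarrow>
       X j $$ (k, l) = \<rho> * (transpose_mat V * T j * V) $$ (k, l)"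
    and spec: "\<And>t. t \<in> joint_spectrum g (g * 1) T \<Longrightarrow> scalar_tuple t \<in> free_spectrahedron g d A 1"
    by (rule admissible_scaleE[OF adm A]) (rule that)
  define B where "B = scalar_tuple (\<lambda>j. if j = 0 then - 1 else 0)"
  define z where "z = (transpose_mat V * T 0 * V) $$ (0, 0)"
  have "(\<Sum>j<g. \<Sum>k<1. \<Sum>l<1. B j $$ (k, l) * (transpose_mat V * T j * V) $$ (k, l))
      \<le> 1 * (\<Sum>i<g * 1. \<Sum>k<1. (V $$ (i, k))\<^sup>2)"
  proof (rule commuting_compression_bound[OF T _ V(1)])
    show "B \<in> sym_tuples g 1" by (auto simp: B_def scalar_tuple_def sym_tuples_def intro!: sym_matsI)
    fix t and y :: "nat \<Rightarrow> real" assume "t \<in> joint_spectrum g (g * 1) T"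
    then have "(\<Sum>j<g. (if j = 0 then - 1 else 0) * qform 1 (scalar_tuple t j) y) \<le> (\<Sum>p<1. (y p)\<^sup>2)"
      using spec iff axis[of 0 "- 1"] \<open>g \<ge> 1\<close> by force
    moreover have "(\<Sum>j<g. t j * qform 1 (B j) y) = (\<Sum>j<g. (if j = 0 then - 1 else 0) * qform 1 (scalar_tuple t j) y)"
      by (intro sum.cong refl) (simp add: B_def scalar_tuple_def bform_def)
    ultimately show "(\<Sum>j<g. t j * qform 1 (B j) y) \<le> 1 * (\<Sum>k<1. (y k)\<^sup>2)" by simp
  qed
  moreover have "(\<Sum>j<g. \<Sum>k<1. \<Sum>l<1. B j $$ (k, l) * (transpose_mat V * T j * V) $$ (k, l))
      = (\<Sum>j<g. (if j = 0 then - 1 else 0) * (transpose_mat V * T j * V) $$ (0, 0))"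
    by (intro sum.cong refl) (simp add: B_def scalar_tuple_def)
  ultimately have "- z \<le> 1" using V(2) sum_single_coordinate[of 0 g "- 1"] \<open>g \<ge> 1\<close> by (simp add: z_def)
  have "M = \<rho> * z" using dil[of 0 0 0] \<open>g \<ge> 1\<close> by (simp add: X_def scalar_tuple_def z_def)
  also have "\<dots> \<le> - \<rho>" using mult_left_mono[OF \<open>- z \<le> 1\<close>, of "- \<rho>"] \<open>\<rho> \<le> 0\<close> by simp
  finally show False by (simp add: M_def)
qed

text \<open>
  With \<open>X = F\<close> and \<open>B = F\<close>, the compression bound turns \<open>F\<^sub>j = \<rho> V\<^sup>* T\<^sub>j V\<close> into
  \<open>g (N - g) \<le> \<rho> N\<close> for every grid size \<open>N > g\<close>; let \<open>N\<close> grow.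
\<close>

lemma admissible_scale_ge:
  assumes "g \<ge> 1" and adm: "admissible_scale g \<rho>"
  shows "real g \<le> \<rho>"
proof -
  have "\<rho> > 0" using admissible_scale_pos[OF assms] .
  obtain n F where "n > 0" and F: "clifford_tuple g n F" using clifford_tuple_exists by blast
  have Fs: "F \<in> sym_tuples g n" using F by (simp add: clifford_tuple_def)
  have key: "real g * (real N - real g) \<le> \<rho> * real N" if "N > g" for N :: nat
  proof -
    have "N \<ge> 1" using that by simp
    then obtain d A where
      A: "A \<in> sym_tuples g d" "free_bounded g (free_spectrahedron g d A)"
        "coord_closed g (free_spectrahedron g d A)"
      and mem: "\<And>n X. X \<in> sym_tuples g n \<Longrightarrow>
       \<forall>a y. (\<Sum>j<g. a j * qform n (X j) y) \<le> sqrt (\<Sum>j<g. (a j)\<^sup>2) * (\<Sum>p<n. (y p)\<^sup>2) \<Longrightarrow>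
       X \<in> free_spectrahedron g d A n"
      and sc: "\<And>t. scalar_tuple t \<in> free_spectrahedron g d A 1 \<Longrightarrow>
        sqrt (\<Sum>j<g. (t j)\<^sup>2) * (real N - real g) \<le> real N"
      by (rule ball_grid_spectrahedron[of N g]) (rule that)
    have "F \<in> free_spectrahedron g d A n" using Fs clifford_norm_bound[OF F] by (intro mem) auto
    then obtain T V where
      T: "T \<in> sym_tuples g (g * n)" "commuting_tuple g T" and V: "V \<in> carrier_mat (g * n) n"
      "(\<Sum>i<g * n. \<Sum>k<n. (V $$ (i, k))\<^sup>2) = real n"
      and dil: "\<And>j k l. j < g \<Longrightarrow> k < n \<Longrightarrow> l < n \<Longrightarrow>
         F j $$ (k, l) = \<rho> * (transpose_mat V * T j * V) $$ (k, l)"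
      and spec: "\<And>t. t \<in> joint_spectrum g (g * n) T \<Longrightarrow> scalar_tuple t \<in> free_spectrahedron g d A 1"
      by (rule admissible_scaleE[OF adm A]) (rule that)
    define R where "R = real N / (real N - real g)"
    have "(\<Sum>j<g. \<Sum>k<n. \<Sum>l<n. F j $$ (k, l) * (transpose_mat V * T j * V) $$ (k, l))
        \<le> R * (\<Sum>i<g * n. \<Sum>k<n. (V $$ (i, k))\<^sup>2)"
    proof (rule commuting_compression_bound[OF T Fs V(1)])
      fix t and y :: "nat \<Rightarrow> real" assume "t \<in> joint_spectrum g (g * n) T"
      then have "sqrt (\<Sum>j<g. (t j)\<^sup>2) \<le> R"
        using sc[OF spec] that by (simp add: R_def pos_le_divide_eq)
      then have "sqrt (\<Sum>j<g. (t j)\<^sup>2) * (\<Sum>k<n. (y k)\<^sup>2) \<le> R * (\<Sum>k<n. (y k)\<^sup>2)"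
        by (intro mult_right_mono sum_nonneg) auto
      then show "(\<Sum>j<g. t j * qform n (F j) y) \<le> R * (\<Sum>k<n. (y k)\<^sup>2)"
        using clifford_norm_bound[OF F, of t y] by linarith
    qed
    also have "\<dots> = R * n" by (simp add: V(2))
    also have "(\<Sum>j<g. \<Sum>k<n. \<Sum>l<n. F j $$ (k, l) * (transpose_mat V * T j * V) $$ (k, l))
        = (\<Sum>j<g. (\<Sum>k<n. \<Sum>l<n. (F j $$ (k, l))\<^sup>2) / \<rho>)"
      unfolding sum_divide_distrib using \<open>\<rho> > 0\<close>
      by (intro sum.cong refl) (simp add: dil power2_eq_square)
    also have "\<dots> = g * n / \<rho>" using clifford_frobenius_norm[OF F] by simp
    finally have "g * n / \<rho> \<le> R * n" .
    then have "g \<le> R * \<rho>" using \<open>n > 0\<close> \<open>\<rho> > 0\<close> by (simp add: field_simps)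
    then show ?thesis using that by (simp add: R_def field_simps)
  qed
  show ?thesis
  proof (rule ccontr)
    assume "\<not> real g \<le> \<rho>"
    then have gap: "real g - \<rho> > 0" by simp
    obtain N :: nat where N: "real N > (real g)\<^sup>2 / (real g - \<rho>) + real g" using reals_Archimedean2 by blast
    have "(real g)\<^sup>2 / (real g - \<rho>) \<ge> 0" using gap by simp
    then have "N > g" using N by linarith
    have "real N > (real g)\<^sup>2 / (real g - \<rho>)" using N by linarith
    then have "(real g)\<^sup>2 < real N * (real g - \<rho>)" using gap by (simp add: pos_divide_less_eq)
    then show False using key[OF \<open>N > g\<close>] by (simp add: algebra_simps power2_eq_square)
  qed
qed

theorem proposition14p1:
  fixes g :: nat
  assumes "g \<ge> 1"
  shows
    "(\<forall>d A n C.
        A \<in> sym_tuples g d \<longrightarrow>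
        free_bounded g (free_spectrahedron g d A) \<longrightarrow>
        coord_closed g (free_spectrahedron g d A) \<longrightarrow>
        C \<in> free_spectrahedron g d A n \<longrightarrow>
        (\<exists>T \<in> free_spectrahedron g d A (g * n).
           commuting_tuple g T \<and> dilates_to g n (g * n) C (scale_tuple (real g) T)))
     \<and>
     (let admissible = {\<rho> :: real. \<forall>d A n X.
        A \<in> sym_tuples g d \<longrightarrow>
        free_bounded g (free_spectrahedron g d A) \<longrightarrow>
        coord_closed g (free_spectrahedron g d A) \<longrightarrow>
        X \<in> free_spectrahedron g d A n \<longrightarrow>
        (\<exists>T \<in> sym_tuples g (g * n).
           commuting_tuple g T \<and> dilates_to g n (g * n) X (scale_tuple \<rho> T) \<and>
           (\<forall>l \<in> joint_spectrum g (g * n) T. scalar_tuple l \<in> free_spectrahedron g d A 1))}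
      in real g \<in> admissible \<and> (\<forall>\<rho> \<in> admissible. real g \<le> \<rho>))"
proof (intro conjI)
  have block: "block_tuple g n C \<in> free_spectrahedron g d A (g * n) \<and> commuting_tuple g (block_tuple g n C)
      \<and> dilates_to g n (g * n) C (scale_tuple (real g) (block_tuple g n C))"
    if "A \<in> sym_tuples g d" "coord_closed g (free_spectrahedron g d A)" "C \<in> free_spectrahedron g d A n"
    for d A n C
    using that block_tuple_in_free_spectrahedron[OF that(1,3,2)] block_tuple_commuting
      dilates_to_block_tuple[OF assms] by (simp add: free_spectrahedron_def)
  then show "\<forall>d A n C.
        A \<in> sym_tuples g d \<longrightarrow>
        free_bounded g (free_spectrahedron g d A) \<longrightarrow>
        coord_closed g (free_spectrahedron g d A) \<longrightarrow>
        C \<in> free_spectrahedron g d A n \<longrightarrow>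
        (\<exists>T \<in> free_spectrahedron g d A (g * n).
           commuting_tuple g T \<and> dilates_to g n (g * n) C (scale_tuple (real g) T))"
    by blast
  have "admissible_scale g (real g)"
    unfolding admissible_scale_def
  proof (intro allI impI)
    fix d A n X
    assume A: "A \<in> sym_tuples g d" and cc: "coord_closed g (free_spectrahedron g d A)"
      and X: "X \<in> free_spectrahedron g d A n"
    note T = block[OF A cc X]
    show "\<exists>T \<in> sym_tuples g (g * n).
           commuting_tuple g T \<and> dilates_to g n (g * n) X (scale_tuple (real g) T) \<and>
           (\<forall>l \<in> joint_spectrum g (g * n) T. scalar_tuple l \<in> free_spectrahedron g d A 1)"
    proof (rule bexI[of _ "block_tuple g n X"])
      show "block_tuple g n X \<in> sym_tuples g (g * n)" using T by (simp add: free_spectrahedron_def)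
    qed (use T joint_spectrum_in_free_spectrahedron[OF A] in blast)
  qed
  then have "real g \<in> Collect (admissible_scale g) \<and> (\<forall>\<rho>\<in>Collect (admissible_scale g). real g \<le> \<rho>)"
    using admissible_scale_ge[OF assms] by blast
  then show "let admissible = {\<rho> :: real. \<forall>d A n X.
        A \<in> sym_tuples g d \<longrightarrow>
        free_bounded g (free_spectrahedron g d A) \<longrightarrow>
        coord_closed g (free_spectrahedron g d A) \<longrightarrow>
        X \<in> free_spectrahedron g d A n \<longrightarrow>
        (\<exists>T \<in> sym_tuples g (g * n).
           commuting_tuple g T \<and> dilates_to g n (g * n) X (scale_tuple \<rho> T) \<and>
           (\<forall>l \<in> joint_spectrum g (g * n) T. scalar_tuple l \<in> free_spectrahedron g d A 1))}
      in real g \<in> admissible \<and> (\<forall>\<rho> \<in> admissible. real g \<le> \<rho>)"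
    unfolding Let_def admissible_scale_def .
qed

end
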